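(* Let $k$ be a field, let $m\geq 6$, let $S=k[a_i,b_i,c_i]_{i=1}^m$ be a polynomial ring in $n=3m$ variables, with indices read modulo $m$, and let $F$ be the element of the divided power ring $P$ associated to $S$ that is dual to the polynomial $$\sum_{i=1}^m \left(a_ib_ic_i + a_ia_{i+1}^2 + b_ib_{i+1}^2 + c_ic_{i+1}^2\right).$$ Then the apolar algebra $\mathrm{Apolar}(F)=S/\mathrm{Ann}(F)$ satisfies the small tangent space condition.
   Context: $P$ is the $k$-vector space with basis consisting of symbols $\mu^{*}$, one for each monomial $\mu$ of $S$ (the dual basis to the monomials of $S$), with $\deg\mu^*=\deg\mu$. $S$ acts on $P$ by contraction: for monomials $\nu,\mu$, $\nu\cdot\mu^{*}=(\mu/\nu)^{*}$ if $\nu$ divides $\mu$, and $0$ otherwise. The element of $P$ dual to a polynomial $\sum_\mu c_\mu\mu$ is $\sum_\mu c_\mu\mu^{*}$. For $f\in P$, $\mathrm{Ann}(f)=\{s\in S : s\cdot f=0\}$. For a graded $S$-module $M$ write $H(M)_i=\dim_k M_i$ ($S$ has the standard grading). "$M$ has Hilbert function $(h_0,\dots,h_j)$" means $H(M)_i=h_i$ for $0\le i\le j$ and $H(M)_i=0$ otherwise. Small tangent space condition ($n$ = number of variables of $S$): for $f\in P$ homogeneous of degree $3$ and $I=\mathrm{Ann}(f)$, $\mathrm{Apolar}(f)$ satisfies it if $S/I$ has Hilbert function $(1,n,n,1)$, $H(S/I^2)_4=n$ and $H(S/I^2)_5=0$. *)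

theory Defs
  imports
    "HOL-Library.Poly_Mapping"
    "HOL-Algebra.Embedded_Algebras"
    "HOL-Algebra.Ideal_Product"
    "HOL-Algebra.QuotRing"
begin

section \<open>Polynomial rings on a set of variables\<close>

type_synonym 'v monom = "'v \<Rightarrow>\<^sub>0 nat"
type_synonym ('v, 'k) mpoly = "'v monom \<Rightarrow>\<^sub>0 'k"

definition mdeg :: "'v monom \<Rightarrow> nat" where
  "mdeg \<mu> = (\<Sum>v\<in>Poly_Mapping.keys \<mu>. Poly_Mapping.lookup \<mu> v)"

definition mdvd :: "'v monom \<Rightarrow> 'v monom \<Rightarrow> bool" where
  "mdvd \<nu> \<mu> \<longleftrightarrow> (\<exists>\<kappa>. \<mu> = \<nu> + \<kappa>)"

definition monoms_on :: "'v set \<Rightarrow> 'v monom set" where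
  "monoms_on V = {\<mu>. Poly_Mapping.keys \<mu> \<subseteq> V}"

text \<open>The ring $k[V]$, realised inside the polynomials over all variables of type \<open>'v\<close>.\<close>

definition poly_ring :: "'v set \<Rightarrow> ('v, 'k::field) mpoly ring" where
  "poly_ring V =
     \<lparr> carrier = {p. Poly_Mapping.keys p \<subseteq> monoms_on V},
       mult = (*), one = 1, zero = 0, add = (+) \<rparr>"

definition PVar :: "'v \<Rightarrow> ('v, 'k::field) mpoly" where
  "PVar v = Poly_Mapping.single (Poly_Mapping.single v 1) 1"

definition PConst :: "'k \<Rightarrow> ('v, 'k::field) mpoly" where
  "PConst c = Poly_Mapping.single 0 c"

definition graded_part :: "'v set \<Rightarrow> nat \<Rightarrow> ('v, 'k::field) mpoly set" where
  "graded_part V i = {p \<in> carrier (poly_ring V). \<forall>\<mu>\<in>Poly_Mapping.keys p. mdeg \<mu> = i}"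

section \<open>The dual module, contraction and annihilators\<close>

text \<open>\<open>Dual \<mu>\<close> is the symbol $\mu^*$; elements of $P$ are finitely supported
  combinations of these symbols.\<close>

datatype 'v dual_monom = Dual "'v monom"

type_synonym ('v, 'k) dpoly = "'v dual_monom \<Rightarrow>\<^sub>0 'k"

definition dual_space :: "'v set \<Rightarrow> ('v, 'k::field) dpoly set" where
  "dual_space V = {f. Poly_Mapping.keys f \<subseteq> Dual ` monoms_on V}"

definition dual_graded_part :: "'v set \<Rightarrow> nat \<Rightarrow> ('v, 'k::field) dpoly set" where
  "dual_graded_part V i = {f \<in> dual_space V. \<forall>\<mu>. Dual \<mu> \<in> Poly_Mapping.keys f \<longrightarrow> mdeg \<mu> = i}"

definition dual_element :: "('v, 'k::field) mpoly \<Rightarrow> ('v, 'k) dpoly" where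
  "dual_element p = (\<Sum>\<mu>\<in>Poly_Mapping.keys p. Poly_Mapping.single (Dual \<mu>) (Poly_Mapping.lookup p \<mu>))"

text \<open>\<open>contract_term c \<nu> \<mu>\<^sup>*\<close> is $c\,(\nu \cdot \mu^*)$.\<close>

fun contract_term :: "'k \<Rightarrow> 'v monom \<Rightarrow> 'v dual_monom \<Rightarrow> ('v, 'k::field) dpoly" where
  "contract_term c \<nu> (Dual \<mu>) =
     (if mdvd \<nu> \<mu> then Poly_Mapping.single (Dual (\<mu> - \<nu>)) c else 0)"

definition contract :: "('v, 'k::field) mpoly \<Rightarrow> ('v, 'k) dpoly \<Rightarrow> ('v, 'k) dpoly" where
  "contract s f =
     (\<Sum>\<nu>\<in>Poly_Mapping.keys s. \<Sum>\<delta>\<in>Poly_Mapping.keys f. contract_term (Poly_Mapping.lookup s \<nu> * Poly_Mapping.lookup f \<delta>) \<nu> \<delta>)"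

definition Ann :: "'v set \<Rightarrow> ('v, 'k::field) dpoly \<Rightarrow> ('v, 'k) mpoly set" where
  "Ann V f = {s \<in> carrier (poly_ring V). contract s f = 0}"

section \<open>Hilbert functions of quotients by homogeneous ideals\<close>

text \<open>\<open>quot_hilbert V I i d\<close> says $H(S/I)_i = d$ for $S = k[V]$ and \<open>I\<close> a homogeneous
  ideal: the image of $S_i$ in $S/I$ has dimension \<open>d\<close> over the image of the constants, which
  is a copy of $k$ as soon as \<open>I\<close> is proper. It is a relation, as is the library's
  \<open>dimension\<close>.\<close>

definition quot_hilbert ::
    "'v set \<Rightarrow> ('v, 'k::field) mpoly set \<Rightarrow> nat \<Rightarrow> nat \<Rightarrow> bool" where
  "quot_hilbert V I i d \<longleftrightarrow>
     ring.dimension (poly_ring V Quot I) d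
       (range (\<lambda>c. I +>\<^bsub>poly_ring V\<^esub> PConst c))
       ((\<lambda>s. I +>\<^bsub>poly_ring V\<^esub> s) ` graded_part V i)"

definition has_hilbert_function ::
    "'v set \<Rightarrow> ('v, 'k::field) mpoly set \<Rightarrow> nat list \<Rightarrow> bool" where
  "has_hilbert_function V I hs \<longleftrightarrow>
     (\<forall>i. quot_hilbert V I i (if i < length hs then hs ! i else 0))"

text \<open>The small tangent space condition for $\mathrm{Apolar}(f) = S/\mathrm{Ann}(f)$, which
  is only meaningful for \<open>f\<close> homogeneous of degree 3; this is made part of it.\<close>

definition apolar_small_tangent_space :: "'v set \<Rightarrow> ('v, 'k::field) dpoly \<Rightarrow> bool" where
  "apolar_small_tangent_space V f \<longleftrightarrow>
     (let n = card V; I = Ann V f; I2 = I \<cdot>\<^bsub>poly_ring V\<^esub> I in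
        f \<in> dual_graded_part V 3 \<and>
        has_hilbert_function V I [1, n, n, 1] \<and>
        quot_hilbert V I2 4 n \<and>
        quot_hilbert V I2 5 0)"

section \<open>The cubic\<close>

datatype abc_var = A nat | B nat | C nat

text \<open>The indices modulo \<open>m\<close> are represented by \<open>0, \<dots>, m - 1\<close>.\<close>

definition abc_vars :: "nat \<Rightarrow> abc_var set" where
  "abc_vars m = A ` {..<m} \<union> B ` {..<m} \<union> C ` {..<m}"

definition abc_cubic :: "nat \<Rightarrow> (abc_var, 'k::field) mpoly" where
  "abc_cubic m =
     (\<Sum>i<m. let j = Suc i mod m in
        PVar (A i) * PVar (B i) * PVar (C i) + PVar (A i) * PVar (A j) ^ 2
        + PVar (B i) * PVar (B j) ^ 2 + PVar (C i) * PVar (C j) ^ 2)"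

end

theory Submission
  imports Defs
begin

text \<open>Call two variables adjacent if some cubic term of \<open>F\<close> contains both. The ideal
  \<open>I = Ann(F)\<close> contains the product of any two nonadjacent variables, and for each variable
  \<open>y\<close> the differences of the three quadratic monomials \<open>q\<close> with \<open>q \<cdot> F = y\<^sup>*\<close>. Hence, modulo
  \<open>I\<^sup>2\<close>, in a product of a nonadjacent pair with such a \<open>q\<close> one may replace \<open>q\<close> freely. This
  kills the product unless \<open>y\<close> is in the pair, and otherwise identifies it with \<open>z t\<close>, where
  \<open>z\<close> is the other variable of the pair and \<open>t\<close> a fixed term of \<open>F\<close>. The remaining quartic
  monomials have pairwise adjacent variables and are reduced to the previous ones by a product
  of two differences. So \<open>card V\<close> classes span \<open>S/I\<^sup>2\<close> in degree 4; they are independent, because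
  \<open>s \<mapsto> (\<partial>s/\<partial>y) \<cdot> F\<close>, evaluated at the constant term, vanishes on \<open>I\<^sup>2\<close> by the Leibniz rule.
  In degree 5, the class \<open>z t\<close> times a variable is a multiple of two nonadjacent products for
  a suitable choice of \<open>t\<close>.\<close>

section \<open>Monomials and polynomials\<close>

lemma lookup_sum_singles:
  "Poly_Mapping.lookup (\<Sum>\<mu>\<in>S. Poly_Mapping.single \<mu> (f \<mu>)) \<kappa> = (if \<kappa> \<in> S then f \<kappa> else 0)"
  if "finite S"
  using that by (simp add: lookup_sum lookup_single when_def)

lemma sum_singles_eq: "(\<Sum>\<mu>\<in>Poly_Mapping.keys p. Poly_Mapping.single \<mu> (Poly_Mapping.lookup p \<mu>)) = p"
  by (rule poly_mapping_eqI) (simp add: lookup_sum_singles in_keys_iff)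

lemma mdeg_superset:
  "finite S \<Longrightarrow> Poly_Mapping.keys \<mu> \<subseteq> S \<Longrightarrow> mdeg \<mu> = (\<Sum>v\<in>S. Poly_Mapping.lookup \<mu> v)"
  unfolding mdeg_def by (rule sum.mono_neutral_left) (auto simp: in_keys_iff)

lemma keys_add_nat: "Poly_Mapping.keys (\<mu> + \<nu>) = Poly_Mapping.keys \<mu> \<union> Poly_Mapping.keys (\<nu> :: 'v monom)"
  by (auto simp: in_keys_iff lookup_add)

lemma mdeg_add: "mdeg (\<mu> + \<nu>) = mdeg \<mu> + mdeg \<nu>"
proof -
  have "mdeg (\<mu> + \<nu>) = (\<Sum>v\<in>Poly_Mapping.keys \<mu> \<union> Poly_Mapping.keys \<nu>. Poly_Mapping.lookup (\<mu> + \<nu>) v)"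
    by (rule mdeg_superset) (auto simp: keys_add_nat)
  also have "\<dots> = mdeg \<mu> + mdeg \<nu>"
    by (simp add: lookup_add sum.distrib mdeg_superset[of "Poly_Mapping.keys \<mu> \<union> Poly_Mapping.keys \<nu>"])
  finally show ?thesis .
qed

lemma mdeg_single [simp]: "mdeg (Poly_Mapping.single v n) = n"
  by (simp add: mdeg_def)

lemma mdeg_zero [simp]: "mdeg 0 = 0"
  by (simp add: mdeg_def)

lemma mdeg_eq_0_iff [simp]: "mdeg \<mu> = 0 \<longleftrightarrow> \<mu> = 0"
  by (auto simp: mdeg_def in_keys_iff intro!: poly_mapping_eqI)

lemma monoms_on_add [simp]: "\<mu> + \<nu> \<in> monoms_on V \<longleftrightarrow> \<mu> \<in> monoms_on V \<and> \<nu> \<in> monoms_on V"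
  by (simp add: monoms_on_def keys_add_nat)

lemma monoms_on_single [simp]: "Poly_Mapping.single v (Suc 0) \<in> monoms_on V \<longleftrightarrow> v \<in> V"
  by (simp add: monoms_on_def)

lemma monoms_on_zero [simp]: "0 \<in> monoms_on V"
  by (simp add: monoms_on_def)

lemma monom_split:
  assumes "v \<in> Poly_Mapping.keys (\<mu> :: 'v monom)"
  shows "\<mu> = Poly_Mapping.single v 1 + (\<mu> - Poly_Mapping.single v 1)"
  using assms by (auto intro!: poly_mapping_eqI simp: lookup_add lookup_minus lookup_single when_def in_keys_iff)

lemma monom_SucE:
  assumes "\<mu> \<in> monoms_on V" "mdeg \<mu> = Suc n"
  obtains v \<nu> where "v \<in> V" "\<nu> \<in> monoms_on V" "mdeg \<nu> = n" "\<mu> = Poly_Mapping.single v 1 + \<nu>"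
proof -
  have "\<mu> \<noteq> 0" using assms(2) by auto
  then obtain v where v: "v \<in> Poly_Mapping.keys \<mu>"
    by (metis all_not_in_conv lookup_not_eq_zero_eq_in_keys lookup_zero poly_mapping_eqI)
  note s = monom_split[OF v]
  have "mdeg \<mu> = 1 + mdeg (\<mu> - Poly_Mapping.single v 1)"
    by (subst s) (simp add: mdeg_add)
  moreover have "v \<in> V" using v assms(1) by (auto simp: monoms_on_def)
  moreover have "\<mu> - Poly_Mapping.single v 1 \<in> monoms_on V"
    using assms(1) s by (metis monoms_on_add)
  ultimately show ?thesis using that s assms(2) by simp
qed

lemma single_1_eq_iff: "Poly_Mapping.single v (Suc 0) = Poly_Mapping.single w (Suc 0) \<longleftrightarrow> v = w"
  by (metis lookup_single_eq lookup_single_not_eq nat.distinct(1))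

lemma mdeg_1E:
  assumes "\<mu> \<in> monoms_on V" "mdeg \<mu> = 1"
  obtains v where "v \<in> V" "\<mu> = Poly_Mapping.single v 1"
  using monom_SucE[of \<mu> V 0] assms by auto

lemma mdeg_2E:
  assumes "\<mu> \<in> monoms_on V" "mdeg \<mu> = 2"
  obtains v w where "v \<in> V" "w \<in> V" "\<mu> = Poly_Mapping.single v 1 + Poly_Mapping.single w 1"
proof -
  obtain v \<nu> where v: "v \<in> V" "\<nu> \<in> monoms_on V" "mdeg \<nu> = 1" "\<mu> = Poly_Mapping.single v 1 + \<nu>"
    using monom_SucE[of \<mu> V 1] assms by auto
  obtain w where "w \<in> V" "\<nu> = Poly_Mapping.single w 1"
    using mdeg_1E v(2,3) by blast
  then show ?thesis using that v by blast
qed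

abbreviation mon :: "'v monom \<Rightarrow> ('v, 'k::field) mpoly" where
  "mon \<mu> \<equiv> Poly_Mapping.single \<mu> 1"

lemma mon_add: "mon (\<mu> + \<nu>) = mon \<mu> * mon \<nu>"
  by (simp add: mult_single)

lemma PVar_mon: "PVar v = mon (Poly_Mapping.single v 1)"
  by (simp add: PVar_def)

lemma PConst_mult_single: "PConst c * Poly_Mapping.single \<mu> d = Poly_Mapping.single \<mu> (c * d)"
  by (simp add: PConst_def mult_single)

lemma poly_ring_simps [simp]:
  "mult (poly_ring V) = (*)" "one (poly_ring V) = 1" "zero (poly_ring V) = 0" "add (poly_ring V) = (+)"
  by (simp_all add: poly_ring_def)

lemma carrier_poly_ring: "p \<in> carrier (poly_ring V) \<longleftrightarrow> Poly_Mapping.keys p \<subseteq> monoms_on V"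
  by (simp add: poly_ring_def)

lemma carrier_add: "p \<in> carrier (poly_ring V) \<Longrightarrow> q \<in> carrier (poly_ring V) \<Longrightarrow> p + q \<in> carrier (poly_ring V)"
  using keys_add[of p q] by (auto simp: carrier_poly_ring)

lemma carrier_uminus: "p \<in> carrier (poly_ring V) \<Longrightarrow> - p \<in> carrier (poly_ring V)"
  by (auto simp: carrier_poly_ring in_keys_iff)

lemma carrier_minus: "p \<in> carrier (poly_ring V) \<Longrightarrow> q \<in> carrier (poly_ring V) \<Longrightarrow> p - q \<in> carrier (poly_ring V)"
  using carrier_add[of p V "- q"] by (simp add: carrier_uminus)

lemma carrier_mult: "p \<in> carrier (poly_ring V) \<Longrightarrow> q \<in> carrier (poly_ring V) \<Longrightarrow> p * q \<in> carrier (poly_ring V)"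
  using keys_mult[of p q] by (force simp: carrier_poly_ring)

lemma carrier_mon [simp]: "mon \<mu> \<in> carrier (poly_ring V) \<longleftrightarrow> \<mu> \<in> monoms_on V"
  by (simp add: carrier_poly_ring)

lemma carrier_zero [simp]: "0 \<in> carrier (poly_ring V)"
  by (simp add: carrier_poly_ring)

lemma carrier_one [simp]: "1 \<in> carrier (poly_ring V)"
  by (simp add: carrier_poly_ring)

lemma carrier_PConst [simp]: "PConst c \<in> carrier (poly_ring V)"
  by (auto simp: carrier_poly_ring PConst_def)

lemma carrier_PVar [simp]: "PVar v \<in> carrier (poly_ring V) \<longleftrightarrow> v \<in> V"
  by (simp add: PVar_mon)

lemma carrier_sum: "(\<And>x. x \<in> S \<Longrightarrow> f x \<in> carrier (poly_ring V)) \<Longrightarrow> (\<Sum>x\<in>S. f x) \<in> carrier (poly_ring V)"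
  by (induction S rule: infinite_finite_induct) (auto intro: carrier_add)

lemma poly_ring_cring: "cring (poly_ring V)"
proof (rule cringI)
  show "abelian_group (poly_ring V)"
  proof (rule abelian_groupI)
    fix x assume x: "x \<in> carrier (poly_ring V)"
    show "\<exists>y\<in>carrier (poly_ring V). y \<oplus>\<^bsub>poly_ring V\<^esub> x = \<zero>\<^bsub>poly_ring V\<^esub>"
      by (rule bexI[of _ "- x"]) (use carrier_uminus[OF x] in auto)
  qed (simp_all add: carrier_add algebra_simps)
  show "Group.comm_monoid (poly_ring V)"
    by (rule comm_monoidI) (simp_all add: carrier_mult algebra_simps)
qed (simp add: algebra_simps)

lemma poly_ring_ring: "ring (poly_ring V)"
  using poly_ring_cring by (rule cring.axioms)

lemma poly_ring_minus:
  assumes "q \<in> carrier (poly_ring V)"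
  shows "p \<ominus>\<^bsub>poly_ring V\<^esub> q = p - q"
proof -
  interpret cring "poly_ring V" by (rule poly_ring_cring)
  have "\<ominus>\<^bsub>poly_ring V\<^esub> q = - q"
    by (rule minus_equality) (use assms in \<open>simp_all add: carrier_uminus\<close>)
  then show ?thesis by (simp add: a_minus_def)
qed

section \<open>Linear functionals on polynomials, given by their values on monomials\<close>

definition weight_sum :: "('v monom \<Rightarrow> 'k) \<Rightarrow> ('v, 'k::field) mpoly \<Rightarrow> 'k" where
  "weight_sum f p = (\<Sum>\<mu>\<in>Poly_Mapping.keys p. Poly_Mapping.lookup p \<mu> * f \<mu>)"

lemma weight_sum_superset:
  "finite S \<Longrightarrow> Poly_Mapping.keys p \<subseteq> S \<Longrightarrow> weight_sum f p = (\<Sum>\<mu>\<in>S. Poly_Mapping.lookup p \<mu> * f \<mu>)"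
  unfolding weight_sum_def by (rule sum.mono_neutral_left) (auto simp: in_keys_iff)

lemma weight_sum_add: "weight_sum f (p + q) = weight_sum f p + weight_sum f q"
proof -
  let ?S = "Poly_Mapping.keys p \<union> Poly_Mapping.keys q"
  have "weight_sum f (p + q) = (\<Sum>\<mu>\<in>?S. Poly_Mapping.lookup (p + q) \<mu> * f \<mu>)"
    by (rule weight_sum_superset) (use keys_add[of p q] in auto)
  then show ?thesis
    by (simp add: lookup_add sum.distrib distrib_right weight_sum_superset[of ?S])
qed

lemma weight_sum_zero [simp]: "weight_sum f 0 = 0"
  by (simp add: weight_sum_def)

lemma weight_sum_single [simp]: "weight_sum f (Poly_Mapping.single \<mu> c) = c * f \<mu>"
  by (cases "c = 0") (simp_all add: weight_sum_def)

lemma weight_sum_sum: "weight_sum f (\<Sum>x\<in>S. g x) = (\<Sum>x\<in>S. weight_sum f (g x))"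
  by (induction S rule: infinite_finite_induct) (auto simp: weight_sum_add)

lemma weight_sum_uminus: "weight_sum f (- p) = - weight_sum f p"
  using weight_sum_add[of f p "- p"] by (simp add: eq_neg_iff_add_eq_0 add.commute)

lemma weight_sum_minus: "weight_sum f (p - q) = weight_sum f p - weight_sum f q"
  using weight_sum_add[of f p "- q"] by (simp add: weight_sum_uminus)

text \<open>Multiplying by a monomial shifts the values of a functional. Both the ideal property of
  \<open>Ann\<close> and the Leibniz argument for \<open>phi\<close> are computed through
  this.\<close>

lemma weight_sum_mult:
  "weight_sum f (p * q) = (\<Sum>\<mu>\<in>Poly_Mapping.keys p. Poly_Mapping.lookup p \<mu> * weight_sum (\<lambda>\<nu>. f (\<mu> + \<nu>)) q)"
proof -
  have "p * q = (\<Sum>\<mu>\<in>Poly_Mapping.keys p. \<Sum>\<nu>\<in>Poly_Mapping.keys q.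
      Poly_Mapping.single \<mu> (Poly_Mapping.lookup p \<mu>) * Poly_Mapping.single \<nu> (Poly_Mapping.lookup q \<nu>))"
    by (subst (1 2) sum_singles_eq[symmetric]) (rule sum_product)
  then have "weight_sum f (p * q) = (\<Sum>\<mu>\<in>Poly_Mapping.keys p. \<Sum>\<nu>\<in>Poly_Mapping.keys q.
      Poly_Mapping.lookup p \<mu> * Poly_Mapping.lookup q \<nu> * f (\<mu> + \<nu>))"
    by (simp add: weight_sum_sum mult_single)
  then show ?thesis
    by (simp add: weight_sum_def sum_distrib_left mult.assoc)
qed

lemma weight_sum_PConst_mult: "weight_sum f (PConst c * p) = c * weight_sum f p"
  by (cases "c = 0") (simp_all add: PConst_def weight_sum_mult)

lemma weight_sum_add_fun: "weight_sum (\<lambda>\<mu>. f \<mu> + g \<mu>) p = weight_sum f p + weight_sum g p"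
  by (simp add: weight_sum_def distrib_left sum.distrib)

lemma weight_sum_scale_fun: "weight_sum (\<lambda>\<mu>. a * f \<mu>) p = a * weight_sum f p"
  by (simp add: weight_sum_def sum_distrib_left mult.left_commute)

lemma weight_sum_one [simp]: "weight_sum f 1 = f 0"
  using weight_sum_single[of f 0 1] by simp

section \<open>Annihilators and contraction\<close>

text \<open>The symbol \<open>Dual \<kappa>\<close> arises from \<open>\<nu>\<close> acting on
  \<open>Dual \<mu>\<close> only for \<open>\<mu> = \<nu> + \<kappa>\<close>. Annihilation thus
  becomes the vanishing of a family of linear functionals, one for each monomial
  \<open>\<kappa>\<close>.\<close>

lemma lookup_contract:
  "Poly_Mapping.lookup (contract s f) (Dual \<kappa>)
    = weight_sum (\<lambda>\<nu>. Poly_Mapping.lookup f (Dual (\<nu> + \<kappa>))) s"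
proof -
  have ct: "Poly_Mapping.lookup (contract_term c \<nu> \<delta>) (Dual \<kappa>) = (if \<delta> = Dual (\<nu> + \<kappa>) then c else 0)"
    for c :: 'a and \<nu> :: "'b monom" and \<delta>
  proof (cases \<delta>)
    case (Dual \<mu>)
    have "mdvd \<nu> \<mu> \<and> \<mu> - \<nu> = \<kappa> \<longleftrightarrow> \<mu> = \<nu> + \<kappa>"
      by (auto simp: mdvd_def)
    then show ?thesis using Dual by (auto simp: lookup_single when_def)
  qed
  have "Poly_Mapping.lookup (contract s f) (Dual \<kappa>) = (\<Sum>\<nu>\<in>Poly_Mapping.keys s. \<Sum>\<delta>\<in>Poly_Mapping.keys f.
      if \<delta> = Dual (\<nu> + \<kappa>) then Poly_Mapping.lookup s \<nu> * Poly_Mapping.lookup f \<delta> else 0)"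
    by (simp add: contract_def lookup_sum ct)
  also have "\<dots> = (\<Sum>\<nu>\<in>Poly_Mapping.keys s. Poly_Mapping.lookup s \<nu> * Poly_Mapping.lookup f (Dual (\<nu> + \<kappa>)))"
    by (rule sum.cong) (auto simp: in_keys_iff)
  finally show ?thesis by (simp add: weight_sum_def)
qed

lemma Ann_iff:
  "s \<in> Ann V f \<longleftrightarrow> s \<in> carrier (poly_ring V) \<and>
    (\<forall>\<kappa>. weight_sum (\<lambda>\<nu>. Poly_Mapping.lookup f (Dual (\<nu> + \<kappa>))) s = 0)"
proof -
  have "contract s f = 0 \<longleftrightarrow> (\<forall>\<kappa>. Poly_Mapping.lookup (contract s f) (Dual \<kappa>) = 0)"
    by (metis dual_monom.exhaust lookup_zero poly_mapping_eqI)
  then show ?thesis by (simp add: Ann_def lookup_contract)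
qed

lemma Ann_weight_sum:
  "s \<in> Ann V f \<Longrightarrow> weight_sum (\<lambda>\<nu>. Poly_Mapping.lookup f (Dual (\<nu> + \<kappa>))) s = 0"
  by (simp add: Ann_iff)

text \<open>The functional of \<open>r * s\<close> at \<open>\<kappa>\<close> is a combination of
  the functionals of \<open>s\<close> at the shifted places \<open>\<mu> + \<kappa>\<close>, all of
  which vanish.\<close>

lemma Ann_mult:
  assumes "s \<in> Ann V f" "r \<in> carrier (poly_ring V)"
  shows "r * s \<in> Ann V f"
proof -
  have "weight_sum (\<lambda>\<nu>. Poly_Mapping.lookup f (Dual (\<nu> + \<kappa>))) (r * s) = 0" for \<kappa>
    using Ann_weight_sum[OF assms(1), of "_ + \<kappa>"]
    by (simp add: weight_sum_mult add.left_commute add.assoc)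
  then show ?thesis using assms by (auto simp: Ann_iff intro: carrier_mult)
qed

lemma Ann_ideal: "ideal (Ann V f) (poly_ring V)"
proof (rule idealI)
  show "subgroup (Ann V f) (add_monoid (poly_ring V))"
  proof -
    interpret cring "poly_ring V" by (rule poly_ring_cring)
    have inv: "inv\<^bsub>add_monoid (poly_ring V)\<^esub> s = - s" if "s \<in> carrier (poly_ring V)" for s :: "('a, 'b) mpoly"
      using minus_equality[of "- s" s] that by (simp add: carrier_uminus a_inv_def)
    show ?thesis
      by (rule subgroup.intro)
        (auto simp: Ann_iff carrier_add weight_sum_add inv[simplified] carrier_uminus weight_sum_uminus)
  qed
next
  fix s r :: "('a, 'b) mpoly" assume "s \<in> Ann V f" "r \<in> carrier (poly_ring V)"
  then show "r \<otimes>\<^bsub>poly_ring V\<^esub> s \<in> Ann V f" "s \<otimes>\<^bsub>poly_ring V\<^esub> r \<in> Ann V f"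
    using Ann_mult[of s V f r] by (simp_all add: mult.commute)
qed (rule poly_ring_ring)

lemma lookup_dual_element: "Poly_Mapping.lookup (dual_element p) (Dual \<mu>) = Poly_Mapping.lookup p \<mu>"
proof -
  have "Poly_Mapping.lookup (dual_element p) (Dual \<mu>)
      = (\<Sum>\<nu>\<in>Poly_Mapping.keys p. if \<nu> = \<mu> then Poly_Mapping.lookup p \<nu> else 0)"
    unfolding dual_element_def lookup_sum by (rule sum.cong) (auto simp: lookup_single when_def)
  then show ?thesis by (simp add: in_keys_iff)
qed

section \<open>Hilbert functions from dual functionals\<close>

text \<open>The preimage of the k-span of the classes of the \<open>v x\<close>. Working with
  representatives lets spanning be checked by polynomial identities modulo \<open>J\<close>, without
  cosets.\<close>

definition ideal_span :: "'v set \<Rightarrow> ('v, 'k::field) mpoly set \<Rightarrow> 'x set \<Rightarrow> ('x \<Rightarrow> ('v, 'k) mpoly) \<Rightarrow> ('v, 'k) mpoly set" where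
  "ideal_span V J X v = {p. \<exists>c. p - (\<Sum>x\<in>X. PConst (c x) * v x) \<in> J}"

context
  fixes V :: "'v set" and J :: "('v, 'k::field) mpoly set"
  assumes J: "ideal J (poly_ring V)"
begin

interpretation J: ideal J "poly_ring V" by (rule J)

lemma ideal_zero: "0 \<in> J"
  using additive_subgroup.zero_closed[OF J.additive_subgroup_axioms] by simp

lemma ideal_add: "p \<in> J \<Longrightarrow> q \<in> J \<Longrightarrow> p + q \<in> J"
  using additive_subgroup.a_closed[OF J.additive_subgroup_axioms] by simp

lemma ideal_mult: "p \<in> J \<Longrightarrow> q \<in> carrier (poly_ring V) \<Longrightarrow> q * p \<in> J"
  using J.I_l_closed[of p q] by simp

lemma ideal_uminus: "p \<in> J \<Longrightarrow> - p \<in> J"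
  using ideal_mult[of p "- 1"] by (simp add: carrier_uminus)

lemma ideal_minus: "p \<in> J \<Longrightarrow> q \<in> J \<Longrightarrow> p - q \<in> J"
  using ideal_add[of p "- q"] by (simp add: ideal_uminus)

lemma ideal_sum: "(\<And>x. x \<in> S \<Longrightarrow> f x \<in> J) \<Longrightarrow> (\<Sum>x\<in>S. f x) \<in> J"
  by (induction S rule: infinite_finite_induct) (auto intro: ideal_add ideal_zero)

lemma coset_eq_iff:
  assumes "p \<in> carrier (poly_ring V)" "q \<in> carrier (poly_ring V)"
  shows "J +>\<^bsub>poly_ring V\<^esub> p = J +>\<^bsub>poly_ring V\<^esub> q \<longleftrightarrow> p - q \<in> J"
  using ring.quotient_eq_iff_same_a_r_cos[OF poly_ring_ring J assms] poly_ring_minus[OF assms(2)] by simp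

text \<open>The library builds up a dimension by adjoining one vector at a time from outside the
  current span. The functionals \<open>\<phi> x\<close> vanish on \<open>J\<close>, hence descend to
  the quotient, and being dual to the \<open>v x\<close> they certify at each stage that the new
  vector is outside.\<close>

lemma dimension_quotI:
  fixes X :: "'x set" and v :: "'x \<Rightarrow> ('v, 'k) mpoly" and \<phi> :: "'x \<Rightarrow> ('v monom \<Rightarrow> 'k)"
  assumes "finite X" "\<And>x. x \<in> X \<Longrightarrow> v x \<in> carrier (poly_ring V)"
    and "\<And>x p. x \<in> X \<Longrightarrow> p \<in> J \<Longrightarrow> weight_sum (\<phi> x) p = 0"
    and "\<And>x y. x \<in> X \<Longrightarrow> y \<in> X \<Longrightarrow> weight_sum (\<phi> x) (v y) = (if x = y then 1 else 0)"
  shows "ring.dimension (poly_ring V Quot J) (card X)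
       (range (\<lambda>c. J +>\<^bsub>poly_ring V\<^esub> PConst c))
       (range (\<lambda>c. J +>\<^bsub>poly_ring V\<^esub> (\<Sum>x\<in>X. PConst (c x) * v x)))"
  using assms
proof (induction X rule: finite_induct)
  case empty
  interpret Q: ring "poly_ring V Quot J" by (rule J.quotient_is_ring)
  have "J +>\<^bsub>poly_ring V\<^esub> 0 = J"
    using J.a_rcos_const ideal_zero by simp
  then show ?case using Q.zero_dim by (simp add: FactRing_def)
next
  case (insert y X)
  interpret Q: ring "poly_ring V Quot J" by (rule J.quotient_is_ring)
  let ?cos = "\<lambda>p. J +>\<^bsub>poly_ring V\<^esub> p"
  let ?s = "\<lambda>c. \<Sum>x\<in>X. PConst (c x) * v x"
  let ?E = "range (\<lambda>c. ?cos (?s c))"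
  let ?K = "range (\<lambda>c. ?cos (PConst c))"
  have sc: "?s c \<in> carrier (poly_ring V)" for c
    by (rule carrier_sum) (use insert.prems in \<open>auto intro: carrier_mult\<close>)
  have vy: "v y \<in> carrier (poly_ring V)" using insert.prems by simp
  have dim: "Q.dimension (card X) ?K ?E" using insert by simp
  have "?cos (v y) \<notin> ?E"
  proof
    assume "?cos (v y) \<in> ?E"
    then obtain c where "?cos (v y) = ?cos (?s c)" by auto
    then have "v y - ?s c \<in> J" using coset_eq_iff vy sc by blast
    then have "weight_sum (\<phi> y) (v y - ?s c) = 0" using insert.prems by blast
    moreover have "weight_sum (\<phi> y) (?s c) = 0"
      using insert.hyps insert.prems by (auto simp: weight_sum_sum weight_sum_PConst_mult intro!: sum.neutral)
    ultimately show False using insert.prems by (simp add: weight_sum_minus)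
  qed
  moreover have "?cos (v y) \<in> carrier (poly_ring V Quot J)"
    using vy J.a_rcosetsI[OF J.a_subset] by (simp add: FactRing_def)
  ultimately have "Q.dimension (Suc (card X)) ?K (Q.line_extension ?K (?cos (v y)) ?E)"
    using dim by (intro Q.Suc_dim)
  moreover have "Q.line_extension ?K (?cos (v y)) ?E
      = range (\<lambda>c. ?cos (\<Sum>x\<in>insert y X. PConst (c x) * v x))" (is "?L = ?R")
  proof -
    have eq: "?cos (PConst k) \<otimes>\<^bsub>poly_ring V Quot J\<^esub> ?cos (v y) \<oplus>\<^bsub>poly_ring V Quot J\<^esub> ?cos (?s c)
        = ?cos (PConst k * v y + ?s c)" for k c
      using vy sc by (simp add: FactRing_def J.rcoset_mult_add J.a_rcos_sum carrier_mult)
    have ins: "(\<Sum>x\<in>insert y X. PConst (c x) * v x) = PConst (c y) * v y + ?s c" for c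
      using insert.hyps by simp
    show ?thesis
    proof (intro equalityI subsetI)
      fix u assume "u \<in> ?L"
      then obtain k c where "u = ?cos (PConst k * v y + ?s c)"
        using eq by (auto simp: Q.line_extension_mem_iff)
      \<comment> \<open>As \<open>y\<close> is not in \<open>X\<close>, its coefficient is still
        free and can be set to \<open>k\<close>.\<close>
      moreover have "?s c = ?s (c(y := k))"
        using insert.hyps by (intro sum.cong) auto
      ultimately have "u = ?cos (\<Sum>x\<in>insert y X. PConst ((c(y := k)) x) * v x)"
        by (simp only: ins) simp
      then show "u \<in> ?R" by blast
    next
      fix u assume "u \<in> ?R"
      then obtain c where "u = ?cos (PConst (c y) * v y + ?s c)" using ins by auto
      then show "u \<in> ?L" unfolding Q.line_extension_mem_iff using eq[of "c y" c] by auto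
    qed
  qed
  ultimately show ?case using insert.hyps by simp
qed

lemma ideal_span_closed:
  assumes "p \<in> ideal_span V J X v" "q \<in> ideal_span V J X v"
  shows "p + q \<in> ideal_span V J X v" "p - q \<in> ideal_span V J X v"
proof -
  obtain c d where c: "p - (\<Sum>x\<in>X. PConst (c x) * v x) \<in> J" and d: "q - (\<Sum>x\<in>X. PConst (d x) * v x) \<in> J"
    using assms by (auto simp: ideal_span_def)
  have P: "PConst (a + b) = PConst a + PConst b" "PConst (a - b) = PConst a - PConst b" for a b :: 'k
    by (simp_all add: PConst_def single_add single_diff)
  have "p + q - (\<Sum>x\<in>X. PConst (c x + d x) * v x) \<in> J"
    using ideal_add[OF c d] by (simp add: P algebra_simps sum.distrib)
  then show "p + q \<in> ideal_span V J X v"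
    unfolding ideal_span_def by (intro CollectI exI[of _ "\<lambda>x. c x + d x"])
  have "p - q - (\<Sum>x\<in>X. PConst (c x - d x) * v x) \<in> J"
    using ideal_minus[OF c d] by (simp add: P algebra_simps sum_subtractf)
  then show "p - q \<in> ideal_span V J X v"
    unfolding ideal_span_def by (intro CollectI exI[of _ "\<lambda>x. c x - d x"])
qed

lemma ideal_span_PConst:
  assumes "p \<in> ideal_span V J X v"
  shows "PConst a * p \<in> ideal_span V J X v"
proof -
  obtain c where "p - (\<Sum>x\<in>X. PConst (c x) * v x) \<in> J"
    using assms by (auto simp: ideal_span_def)
  then have "PConst a * (p - (\<Sum>x\<in>X. PConst (c x) * v x)) \<in> J"
    by (rule ideal_mult) simp
  moreover have "PConst (a * b) = (PConst a * PConst b :: ('v, 'k) mpoly)" for b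
    by (simp add: PConst_def mult_single)
  ultimately have "PConst a * p - (\<Sum>x\<in>X. PConst (a * c x) * v x) \<in> J"
    by (simp add: right_diff_distrib mult.assoc sum_distrib_left)
  then show ?thesis
    unfolding ideal_span_def by (intro CollectI exI[of _ "\<lambda>x. a * c x"])
qed

lemma ideal_span_ideal: "p \<in> J \<Longrightarrow> p \<in> ideal_span V J X v"
  unfolding ideal_span_def by (rule CollectI, rule exI[of _ "\<lambda>_. 0"]) (simp add: PConst_def)

lemma ideal_span_generator:
  assumes "finite X" "x \<in> X" shows "v x \<in> ideal_span V J X v"
proof -
  have "(\<Sum>y\<in>X. PConst (if y = x then 1 else 0) * v y) = (\<Sum>y\<in>X. if y = x then v y else 0)"
    by (rule sum.cong) (auto simp: PConst_def)
  also have "\<dots> = v x" using assms by simp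
  finally show ?thesis
    unfolding ideal_span_def using ideal_zero by (intro CollectI exI[of _ "\<lambda>y. if y = x then 1 else 0"]) simp
qed

lemma ideal_span_cong: "p - q \<in> J \<Longrightarrow> q \<in> ideal_span V J X v \<Longrightarrow> p \<in> ideal_span V J X v"
  using ideal_span_closed(1)[of "p - q" X v q] by (simp add: ideal_span_ideal)

lemma ideal_span_sum:
  "(\<And>x. x \<in> S \<Longrightarrow> f x \<in> ideal_span V J X v) \<Longrightarrow> (\<Sum>x\<in>S. f x) \<in> ideal_span V J X v"
  by (induction S rule: infinite_finite_induct)
    (auto intro: ideal_span_closed ideal_span_ideal ideal_zero)

text \<open>Upper and lower bound in one rule: reducing the monomials of degree \<open>i\<close> to
  the \<open>v x\<close> shows that these span, and dual functionals vanishing on \<open>J\<close>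
  show that they are independent. Homogeneity of the \<open>v x\<close> places their span inside the
  image of the graded part.\<close>

lemma quot_hilbertI:
  fixes X :: "'x set" and v :: "'x \<Rightarrow> ('v, 'k) mpoly" and \<phi> :: "'x \<Rightarrow> ('v monom \<Rightarrow> 'k)"
  assumes X: "finite X" and vV: "\<And>x. x \<in> X \<Longrightarrow> v x \<in> graded_part V i"
    and "\<And>x p. x \<in> X \<Longrightarrow> p \<in> J \<Longrightarrow> weight_sum (\<phi> x) p = 0"
    and "\<And>x y. x \<in> X \<Longrightarrow> y \<in> X \<Longrightarrow> weight_sum (\<phi> x) (v y) = (if x = y then 1 else 0)"
    and span: "\<And>\<mu>. \<mu> \<in> monoms_on V \<Longrightarrow> mdeg \<mu> = i \<Longrightarrow> mon \<mu> \<in> ideal_span V J X v"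
  shows "quot_hilbert V J i (card X)"
proof -
  let ?cos = "\<lambda>p. J +>\<^bsub>poly_ring V\<^esub> p"
  let ?s = "\<lambda>c. \<Sum>x\<in>X. PConst (c x) * v x"
  have sc: "?s c \<in> carrier (poly_ring V)" for c
    by (rule carrier_sum) (use vV in \<open>auto intro: carrier_mult simp: graded_part_def\<close>)
  have sg: "?s c \<in> graded_part V i" for c
  proof -
    have "mdeg \<mu> = i" if \<mu>: "\<mu> \<in> Poly_Mapping.keys (?s c)" for \<mu>
    proof -
      obtain x where x: "x \<in> X" "\<mu> \<in> Poly_Mapping.keys (PConst (c x) * v x)"
        using \<mu> unfolding in_keys_iff lookup_sum by (rule sum.not_neutral_contains_not_neutral)
      then have "\<mu> \<in> Poly_Mapping.keys (v x)"
        using keys_mult[of "PConst (c x)" "v x"] by (auto simp: PConst_def split: if_splits)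
      then show ?thesis using vV x by (auto simp: graded_part_def)
    qed
    then show ?thesis using sc by (auto simp: graded_part_def)
  qed
  have "?cos ` graded_part V i = range (\<lambda>c. ?cos (?s c))"
  proof (intro equalityI subsetI)
    fix u assume "u \<in> ?cos ` graded_part V i"
    then obtain p where p: "p \<in> graded_part V i" "u = ?cos p" by auto
    have pc: "p \<in> carrier (poly_ring V)" using p by (simp add: graded_part_def)
    have "p = (\<Sum>\<mu>\<in>Poly_Mapping.keys p. PConst (Poly_Mapping.lookup p \<mu>) * mon \<mu>)"
      by (subst sum_singles_eq[symmetric]) (simp add: PConst_mult_single)
    moreover have "mon \<mu> \<in> ideal_span V J X v" if "\<mu> \<in> Poly_Mapping.keys p" for \<mu>
      by (rule span) (use that p in \<open>auto simp: graded_part_def carrier_poly_ring\<close>)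
    ultimately have "p \<in> ideal_span V J X v"
      by (metis (no_types, lifting) ideal_span_PConst ideal_span_sum)
    then obtain c where "p - ?s c \<in> J" by (auto simp: ideal_span_def)
    then have "u = ?cos (?s c)" using coset_eq_iff[OF pc sc] p by simp
    then show "u \<in> range (\<lambda>c. ?cos (?s c))" by blast
  qed (use sg in blast)
  then show ?thesis
    unfolding quot_hilbert_def using dimension_quotI[of X v \<phi>] assms by (simp add: graded_part_def)
qed

lemma quot_hilbert_zeroI:
  assumes "\<And>\<mu>. \<mu> \<in> monoms_on V \<Longrightarrow> mdeg \<mu> = i \<Longrightarrow> mon \<mu> \<in> J"
  shows "quot_hilbert V J i 0"
  using quot_hilbertI[of "{}" undefined i] assms by (simp add: ideal_span_ideal)

end

section \<open>The cubic\<close>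

datatype letter = LA | LB | LC

lemma UNIV_letter: "UNIV = {LA, LB, LC}"
  using letter.exhaust by auto

lemma letter_thirdE:
  assumes "l \<noteq> (p::letter)"
  obtains r where "r \<noteq> l" "r \<noteq> p" "\<And>q. q = l \<or> q = p \<or> q = r"
  using assms that by (metis letter.exhaust letter.distinct)

lemma letter_othersE:
  obtains p r where "p \<noteq> (l::letter)" "r \<noteq> l" "r \<noteq> p" "\<And>q. q = l \<or> q = p \<or> q = r"
  using that by (metis letter.exhaust letter.distinct)

text \<open>Letters are taken apart from indices, and indices are integers modulo \<open>m\<close>, so that the
  symmetry of the cubic under permuting the letters and shifting the indices is visible.\<close>

fun cvar :: "nat \<Rightarrow> letter \<Rightarrow> int \<Rightarrow> abc_var" where
  "cvar m LA i = A (nat (i mod int m))"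
| "cvar m LB i = B (nat (i mod int m))"
| "cvar m LC i = C (nat (i mod int m))"

text \<open>A fixed choice of a letter different from that of the variable, from which the basis
  monomial \<open>mu\<close> is formed.\<close>

fun other_letter :: "abc_var \<Rightarrow> letter" where
  "other_letter (A _) = LB" | "other_letter (B _) = LC" | "other_letter (C _) = LA"

fun var_index :: "abc_var \<Rightarrow> int" where
  "var_index (A i) = int i" | "var_index (B i) = int i" | "var_index (C i) = int i"

lemma cvar_eq_iff: "m > 0 \<Longrightarrow> cvar m l i = cvar m p j \<longleftrightarrow> l = p \<and> int m dvd i - j"
proof -
  assume "m > 0"
  then have "nat (i mod int m) = nat (j mod int m) \<longleftrightarrow> int m dvd i - j"
    by (simp add: eq_nat_nat_iff mod_eq_dvd_iff)
  then show ?thesis by (cases l; cases p) auto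
qed

declare cvar.simps [simp del]

locale cyclic_cubic =
  fixes m :: nat and F :: "(abc_var, 'k::field) dpoly"
  assumes m: "m \<ge> 6" and F: "F = dual_element (abc_cubic m)"
begin

abbreviation "V \<equiv> abc_vars m"
abbreviation "X \<equiv> cvar m"
abbreviation "I \<equiv> Ann V F"
abbreviation "I2 \<equiv> I \<cdot>\<^bsub>poly_ring V\<^esub> I"

abbreviation x :: "letter \<Rightarrow> int \<Rightarrow> (abc_var, 'k) mpoly" where "x l i \<equiv> PVar (X l i)"
abbreviation sx :: "letter \<Rightarrow> int \<Rightarrow> abc_var monom" where "sx l i \<equiv> Poly_Mapping.single (X l i) 1"

lemma X_eq [simp]: "X l i = X p j \<longleftrightarrow> l = p \<and> int m dvd i - j"
  by (rule cvar_eq_iff) (use m in simp)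

text \<open>The bound on \<open>m\<close> enters the adjacency computations here: indices less than
  6 apart are congruent only when equal.\<close>

lemma small_dvd: "\<bar>c\<bar> < 6 \<Longrightarrow> int m dvd c \<longleftrightarrow> c = 0"
  using m dvd_imp_le_int[of c "int m"] by auto

lemma X_in_V [simp]: "X l i \<in> V"
proof -
  have "nat (i mod int m) < m" using m by (simp add: nat_less_iff)
  then show ?thesis by (cases l) (auto simp: abc_vars_def cvar.simps)
qed

lemma V_cases:
  assumes "y \<in> V" obtains l i where "y = X l i"
proof -
  have "A i = X LA (int i)" "B i = X LB (int i)" "C i = X LC (int i)" if "i < m" for i
    using that by (simp_all add: cvar.simps)
  then show ?thesis using assms that unfolding abc_vars_def by fast
qed

lemma V_finite: "finite V" by (simp add: abc_vars_def)

section \<open>The terms of the cubic\<close>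

definition alpha :: "letter \<Rightarrow> int \<Rightarrow> abc_var monom" where
  "alpha l i = sx l i + sx l (i + 1) + sx l (i + 1)"

definition delta :: "int \<Rightarrow> abc_var monom" where
  "delta i = sx LA i + sx LB i + sx LC i"

text \<open>The support of \<open>F\<close>. Indices run over all integers, so a term is listed once
  for each representative of its index modulo \<open>m\<close>.\<close>

definition T :: "abc_var monom set" where
  "T = {alpha l i | l i. True} \<union> range delta"

lemma delta_eq: "l \<noteq> p \<Longrightarrow> l \<noteq> r \<Longrightarrow> p \<noteq> r \<Longrightarrow> delta i = sx l i + sx p i + sx r i"
  by (cases l; cases p; cases r) (simp_all add: delta_def ac_simps)

lemma lookup_alpha: "Poly_Mapping.lookup (alpha l i) (X p j)
    = (if l = p then of_bool (int m dvd i - j) + 2 * of_bool (int m dvd i + 1 - j) else 0)"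
  by (auto simp: alpha_def lookup_add lookup_single when_def)

lemma lookup_delta: "Poly_Mapping.lookup (delta i) (X p j) = of_bool (int m dvd i - j)"
  by (cases p) (auto simp: delta_def lookup_add lookup_single when_def)

lemma X_cong: "int m dvd i - j \<Longrightarrow> X l i = X l j" by simp

lemma alpha_cong: "int m dvd i - j \<Longrightarrow> alpha l i = alpha l j"
  using X_cong[of i j l] X_cong[of "i + 1" "j + 1" l] by (simp add: alpha_def del: X_eq)

lemma delta_cong: "int m dvd i - j \<Longrightarrow> delta i = delta j"
  using X_cong[of i j] by (simp add: delta_def del: X_eq)

text \<open>The doubled variable is the mark of an \<open>alpha\<close>: it recovers the letter and
  the index modulo \<open>m\<close>, and a \<open>delta\<close> has none.\<close>

lemma lookup_alpha_2: "Poly_Mapping.lookup (alpha l i) (X p j) \<ge> 2 \<longleftrightarrow> l = p \<and> int m dvd i + 1 - j"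
  by (auto simp: lookup_alpha)

lemma alpha_eq_iff: "alpha l i = alpha p j \<longleftrightarrow> l = p \<and> int m dvd i - j"
proof
  assume "alpha l i = alpha p j"
  then show "l = p \<and> int m dvd i - j"
    using lookup_alpha_2[of l i l "i + 1"] lookup_alpha_2[of p j l "i + 1"]
    by (simp add: dvd_diff_commute)
qed (auto intro: alpha_cong)

lemma delta_neq_alpha: "delta i \<noteq> alpha l j"
proof
  assume eq: "delta i = alpha l j"
  have "Poly_Mapping.lookup (alpha l j) (X l (j + 1)) \<ge> 2"
    by (simp add: lookup_alpha_2)
  then show False
    unfolding eq[symmetric] lookup_delta by (cases "int m dvd i - (j + 1)") simp_all
qed

lemma delta_eq_iff: "delta i = delta j \<longleftrightarrow> int m dvd i - j"
proof
  assume eq: "delta i = delta j"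
  have "Poly_Mapping.lookup (delta j) (X LA j) = 1"
    by (simp add: lookup_delta)
  then show "int m dvd i - j"
    unfolding eq[symmetric] lookup_delta by (cases "int m dvd i - j") simp_all
qed (rule delta_cong)

lemma T_mdeg: "\<mu> \<in> T \<Longrightarrow> mdeg \<mu> = 3"
  by (auto simp: T_def alpha_def delta_def mdeg_add)

lemma T_monoms: "\<mu> \<in> T \<Longrightarrow> \<mu> \<in> monoms_on V"
  by (auto simp: T_def alpha_def delta_def)

lemma int_mod_rep: "\<exists>j<m. int m dvd i - int j"
proof (intro exI conjI)
  show "nat (i mod int m) < m" using m by (simp add: nat_less_iff)
  show "int m dvd i - int (nat (i mod int m))" using m by (simp add: mod_eq_dvd_iff[symmetric])
qed

lemma T_eq: "T = (\<lambda>i. delta (int i)) ` {..<m} \<union> (\<Union>l. (\<lambda>i. alpha l (int i)) ` {..<m})" (is "_ = ?R")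
proof
  show "T \<subseteq> ?R"
  proof
    fix \<mu> assume "\<mu> \<in> T"
    then consider l i where "\<mu> = alpha l i" | i where "\<mu> = delta i" by (auto simp: T_def)
    then show "\<mu> \<in> ?R"
    proof cases
      case (1 l i)
      obtain j where "j < m" "int m dvd i - int j" using int_mod_rep by auto
      then show ?thesis using alpha_cong[of i "int j" l] 1 by auto
    next
      case (2 i)
      obtain j where "j < m" "int m dvd i - int j" using int_mod_rep by auto
      then show ?thesis using delta_cong[of i "int j"] 2 by auto
    qed
  qed
qed (auto simp: T_def)

text \<open>The \<open>4 * m\<close> summands of the cubic are pairwise distinct monomials, so no
  coefficients accumulate, whatever the characteristic. Each family is reindexed injectively by
  residues, and the four families are disjoint.\<close>

lemma abc_cubic_lookup: "Poly_Mapping.lookup (abc_cubic m :: (abc_var, 'k) mpoly) \<mu> = of_bool (\<mu> \<in> T)"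
proof -
  let ?D = "(\<lambda>i. delta (int i)) ` {..<m}" and ?A = "\<lambda>l. (\<lambda>i. alpha l (int i)) ` {..<m}"
  have dv: "int m dvd int i - int j \<longleftrightarrow> i = j" if "i < m" "j < m" for i j
    using that zdvd_not_zless[of "int i - int j" "int m"] zdvd_not_zless[of "int j - int i" "int m"]
    by (cases i j rule: linorder_cases) (auto simp: dvd_diff_commute)
  \<comment> \<open>The cyclic successor in the definition of the cubic becomes plain
    \<open>i + 1\<close>.\<close>
  have step: "X l (int (Suc i mod m)) = X l (int i + 1)" for l i
    by (simp add: mod_eq_dvd_iff[symmetric] zmod_int add.commute)
  have v: "A i = X LA (int i)" "B i = X LB (int i)" "C i = X LC (int i)" if "i < m" for i
    using that by (simp_all add: cvar.simps)
  have "(abc_cubic m :: (abc_var, 'k) mpoly) = (\<Sum>i<m. mon (delta (int i)) + mon (alpha LA (int i))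
      + mon (alpha LB (int i)) + mon (alpha LC (int i)))"
    unfolding abc_cubic_def Let_def
  proof (rule sum.cong)
    fix i assume "i \<in> {..<m}"
    then have i: "i < m" "Suc i mod m < m" using m by auto
    show "(PVar (A i) * PVar (B i) * PVar (C i) + PVar (A i) * PVar (A (Suc i mod m)) ^ 2
        + PVar (B i) * PVar (B (Suc i mod m)) ^ 2 + PVar (C i) * PVar (C (Suc i mod m)) ^ 2 :: (abc_var, 'k) mpoly)
        = mon (delta (int i)) + mon (alpha LA (int i)) + mon (alpha LB (int i)) + mon (alpha LC (int i))"
      by (simp only: v[OF i(1)] v[OF i(2)] step alpha_def delta_def mon_add PVar_mon power2_eq_square mult.assoc)
  qed simp
  also have "\<dots> = (\<Sum>\<mu>\<in>?D. mon \<mu>) + (\<Sum>\<mu>\<in>?A LA. mon \<mu>) + (\<Sum>\<mu>\<in>?A LB. mon \<mu>) + (\<Sum>\<mu>\<in>?A LC. mon \<mu>)"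
    by (subst (1 2 3 4) sum.reindex)
      (auto simp: sum.distrib inj_on_def alpha_eq_iff delta_eq_iff dv)
  also have "Poly_Mapping.lookup \<dots> \<mu>
      = of_bool (\<mu> \<in> ?D) + of_bool (\<mu> \<in> ?A LA) + of_bool (\<mu> \<in> ?A LB) + of_bool (\<mu> \<in> ?A LC)"
    by (simp add: lookup_add lookup_sum_singles)
  also have "\<dots> = of_bool (\<mu> \<in> ?D \<union> (\<Union>l. ?A l))"
  proof -
    have excl: "of_bool d + of_bool a + of_bool b + of_bool c = (of_bool (d \<or> a \<or> b \<or> c) :: 'k)"
      if "d \<Longrightarrow> \<not> a" "d \<Longrightarrow> \<not> b" "d \<Longrightarrow> \<not> c" "a \<Longrightarrow> \<not> b" "a \<Longrightarrow> \<not> c" "b \<Longrightarrow> \<not> c" for a b c d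
      using that by (cases d; cases a; cases b; cases c) simp_all
    have disj: "\<mu> \<in> ?A l \<Longrightarrow> \<mu> \<notin> ?A p" if "l \<noteq> p" for l p
      using that by (auto simp: alpha_eq_iff)
    have disjD: "\<mu> \<in> ?D \<Longrightarrow> \<mu> \<notin> ?A l" for l
      by (auto simp: delta_neq_alpha)
    have "\<mu> \<in> ?D \<union> (\<Union>l. ?A l) \<longleftrightarrow> \<mu> \<in> ?D \<or> \<mu> \<in> ?A LA \<or> \<mu> \<in> ?A LB \<or> \<mu> \<in> ?A LC"
      unfolding UNIV_letter by (simp only: UN_insert UN_empty Un_iff empty_iff simp_thms)
    then show ?thesis
      by (simp only:) (rule excl; (erule disjD | (erule disj[rotated], simp)))
  qed
  finally show ?thesis by (simp only: T_eq)
qed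

lemma lookup_F: "Poly_Mapping.lookup F (Dual \<mu>) = of_bool (\<mu> \<in> T)"
  by (simp add: F lookup_dual_element abc_cubic_lookup)

lemma F_degree: "F \<in> dual_graded_part V 3"
proof -
  have "Poly_Mapping.keys F = Dual ` T"
  proof (rule Set.set_eqI)
    fix \<delta> show "\<delta> \<in> Poly_Mapping.keys F \<longleftrightarrow> \<delta> \<in> Dual ` T"
      by (cases \<delta>) (auto simp: in_keys_iff lookup_F)
  qed
  then show ?thesis using T_monoms T_mdeg by (auto simp: dual_graded_part_def dual_space_def)
qed

section \<open>The annihilator and the adjacency graph of the variables\<close>

lemma I_iff: "s \<in> I \<longleftrightarrow> s \<in> carrier (poly_ring V) \<and> (\<forall>\<kappa>. weight_sum (\<lambda>\<nu>. of_bool (\<nu> + \<kappa> \<in> T)) s = 0)"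
  by (simp add: Ann_iff lookup_F)

lemma I_weight_sum: "s \<in> I \<Longrightarrow> weight_sum (\<lambda>\<nu>. of_bool (\<nu> + \<kappa> \<in> T)) s = 0"
  by (simp add: I_iff)

lemma mon_in_I: "\<mu> \<in> monoms_on V \<Longrightarrow> (\<And>\<kappa>. \<mu> + \<kappa> \<notin> T) \<Longrightarrow> mon \<mu> \<in> I"
  by (simp add: I_iff)

text \<open>Since the nonzero coefficients of \<open>F\<close> are all 1, the contraction of
  \<open>F\<close> by a monomial depends only on the set of its cofactors in
  \<open>T\<close>.\<close>

lemma mon_diff_in_I:
  "\<mu> \<in> monoms_on V \<Longrightarrow> \<nu> \<in> monoms_on V \<Longrightarrow> (\<And>\<kappa>. \<mu> + \<kappa> \<in> T \<longleftrightarrow> \<nu> + \<kappa> \<in> T) \<Longrightarrow> mon \<mu> - mon \<nu> \<in> I"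
  by (simp add: I_iff carrier_minus weight_sum_minus)

text \<open>On \<open>V\<close> this is the complement of a graph made of \<open>m\<close>
  triangles, one for each index, and three cycles of length \<open>m\<close>, one for each letter; a
  variable counts as adjacent to itself. The quantifiers make the relation independent of the
  representatives of the indices, and it is vacuously true outside \<open>V\<close>.\<close>

definition nadj :: "abc_var \<Rightarrow> abc_var \<Rightarrow> bool" where
  "nadj y z \<longleftrightarrow> (\<forall>l i p j. y = X l i \<longrightarrow> z = X p j \<longrightarrow>
     (if l = p then \<not> int m dvd i - j \<and> \<not> int m dvd i + 1 - j \<and> \<not> int m dvd i - 1 - j
      else \<not> int m dvd i - j))"

lemma dvd_shift_cong: "int m dvd i - i' \<Longrightarrow> int m dvd j - j' \<Longrightarrow> int m dvd i + c - j \<longleftrightarrow> int m dvd i' + c - j'"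
proof -
  assume "int m dvd i - i'" "int m dvd j - j'"
  then have "int m dvd (i - i') - (j - j')" by (rule dvd_diff)
  then have "int m dvd (i + c - j) - (i' + c - j')" by (simp add: algebra_simps)
  from dvd_add_right_iff[OF this, of "i' + c - j'"] show ?thesis by (simp only: diff_add_cancel)
qed

lemma nadj_iff: "nadj (X l i) (X p j) \<longleftrightarrow>
   (if l = p then \<not> int m dvd i - j \<and> \<not> int m dvd i + 1 - j \<and> \<not> int m dvd i - 1 - j
      else \<not> int m dvd i - j)"
proof -
  have *: "int m dvd i - j \<longleftrightarrow> int m dvd i' - j'" "int m dvd i + 1 - j \<longleftrightarrow> int m dvd i' + 1 - j'"
      "int m dvd i - 1 - j \<longleftrightarrow> int m dvd i' - 1 - j'"
    if "int m dvd i - i'" "int m dvd j - j'" for i' j'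
    using dvd_shift_cong[OF that, of 0] dvd_shift_cong[OF that, of 1] dvd_shift_cong[OF that, of "-1"] by simp_all
  show ?thesis (is "_ \<longleftrightarrow> ?P")
  proof
    assume "nadj (X l i) (X p j)"
    then show ?P unfolding nadj_def by blast
  next
    assume P: ?P
    show "nadj (X l i) (X p j)"
      unfolding nadj_def
    proof (intro allI impI)
      fix l' i' p' j' assume "X l i = X l' i'" "X p j = X p' j'"
      then have e: "l = l'" "p = p'" and d: "int m dvd i - i'" "int m dvd j - j'" by simp_all
      show "if l' = p' then \<not> int m dvd i' - j' \<and> \<not> int m dvd i' + 1 - j' \<and> \<not> int m dvd i' - 1 - j'
        else \<not> int m dvd i' - j'"
        using P unfolding e *[OF d] .
    qed
  qed
qed

lemma nadj_sym: "nadj y z \<longleftrightarrow> nadj z y"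
proof -
  have "nadj y z" if "nadj z y" for y z
    unfolding nadj_def
  proof (intro allI impI)
    fix l i p j assume "y = X l i" "z = X p j"
    moreover have "int m dvd i - j \<longleftrightarrow> int m dvd j - i" "int m dvd i + 1 - j \<longleftrightarrow> int m dvd j - 1 - i"
      "int m dvd i - 1 - j \<longleftrightarrow> int m dvd j + 1 - i"
      using dvd_diff_commute[of "int m" i j] dvd_diff_commute[of "int m" "i + 1" j]
        dvd_diff_commute[of "int m" "i - 1" j] by (simp_all add: algebra_simps)
    ultimately show "if l = p then \<not> int m dvd i - j \<and> \<not> int m dvd i + 1 - j \<and> \<not> int m dvd i - 1 - j
      else \<not> int m dvd i - j" using that by (simp add: nadj_iff split: if_splits)
  qed
  then show ?thesis by blast
qed

lemma adj_cases:
  assumes "\<not> nadj z (X l i)"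
  obtains "z = X l i" | "z = X l (i + 1)" | "z = X l (i - 1)" | p where "p \<noteq> l" "z = X p i"
proof -
  obtain l' i' p' j' where zz: "z = X l' i'" "X l i = X p' j'"
    using assms unfolding nadj_def by blast
  have c: "\<not> nadj (X l' i') (X l i)" using assms unfolding zz(1) .
  show ?thesis
  proof (cases "l' = l")
    case True
    have "i' - (i - 1) = i' + 1 - i" "i' - (i + 1) = i' - 1 - i" by simp_all
    with c True have "X l' i' = X l i \<or> X l' i' = X l (i - 1) \<or> X l' i' = X l (i + 1)"
      unfolding nadj_iff X_eq by metis
    then show ?thesis using that unfolding zz(1) by metis
  next
    case False
    with c have "X l' i' = X l' i" unfolding nadj_iff X_eq by simp
    then show ?thesis using that(4)[OF False] unfolding zz(1) by metis
  qed
qed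

lemma T_nadj:
  assumes "\<mu> \<in> T" "y \<in> Poly_Mapping.keys \<mu>" "z \<in> Poly_Mapping.keys \<mu>"
  shows "\<not> nadj y z"
  using assms by (auto simp: T_def alpha_def delta_def keys_add_nat nadj_iff)

section \<open>Relations modulo the square of the annihilator\<close>

text \<open>The quadratic monomials contracting \<open>F\<close> to the dual of
  \<open>X l i\<close>, one for each term that contains this variable: \<open>alpha l i\<close>,
  \<open>alpha l (i - 1)\<close> and \<open>delta i\<close>.\<close>

definition qmon :: "letter \<Rightarrow> int \<Rightarrow> abc_var monom set" where
  "qmon l i = {sx l (i + 1) + sx l (i + 1), sx l (i - 1) + sx l i}
     \<union> {sx p i + sx r i | p r. p \<noteq> l \<and> r \<noteq> l \<and> p \<noteq> r}"

lemma m_neq_1 [simp]: "m \<noteq> Suc 0" using m by simp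

lemma T_cases:
  assumes "\<mu> \<in> T"
  obtains l i where "\<mu> = alpha l i" | i where "\<mu> = delta i"
  using assms by (auto simp: T_def)

lemma alpha_in_T: "alpha l i \<in> T" and delta_in_T: "delta i \<in> T"
  by (auto simp: T_def)

lemma qmon_complete: "q \<in> qmon l i \<Longrightarrow> q + sx l i \<in> T"
proof -
  assume "q \<in> qmon l i"
  then consider "q = sx l (i + 1) + sx l (i + 1)" | "q = sx l (i - 1) + sx l i"
    | p r where "p \<noteq> l" "r \<noteq> l" "p \<noteq> r" "q = sx p i + sx r i"
    by (auto simp: qmon_def)
  then show ?thesis
  proof cases
    case 1
    then have "q + sx l i = alpha l i" by (simp add: alpha_def ac_simps)
    then show ?thesis by (simp add: alpha_in_T)
  next
    case 2
    then have "q + sx l i = alpha l (i - 1)" by (simp add: alpha_def ac_simps)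
    then show ?thesis by (simp add: alpha_in_T)
  next
    case (3 p r)
    then have "q + sx l i = delta i" using delta_eq[of p r l i] by simp
    then show ?thesis by (simp add: delta_in_T)
  qed
qed

text \<open>Each such quadric determines the term of \<open>F\<close> that it divides: a square
  identifies an \<open>alpha\<close> by its doubled variable, consecutive indices of one letter
  identify an \<open>alpha\<close>, and two letters at one index identify a
  \<open>delta\<close>.\<close>

lemma qmon_unique:
  assumes q: "q \<in> qmon l i" and t: "q + \<kappa> \<in> T"
  shows "\<kappa> = sx l i"
proof -
  from q consider "q = sx l (i + 1) + sx l (i + 1)" | "q = sx l (i - 1) + sx l i"
    | p r where "p \<noteq> l" "r \<noteq> l" "p \<noteq> r" "q = sx p i + sx r i"
    by (auto simp: qmon_def)
  then have "q + \<kappa> = q + sx l i"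
  proof cases
    case 1
    have ge: "Poly_Mapping.lookup (q + \<kappa>) (X l (i + 1)) \<ge> 2"
      unfolding 1 by (simp add: lookup_add)
    from t show ?thesis
    proof (cases rule: T_cases)
      case (1 p j)
      with ge have "p = l \<and> int m dvd j + 1 - (i + 1)" by (simp only: lookup_alpha_2)
      then have "q + \<kappa> = alpha l i" using alpha_cong[of j i l] 1 by simp
      then show ?thesis using \<open>q = _\<close> by (simp add: alpha_def ac_simps)
    next
      case (2 j)
      show ?thesis using ge unfolding 2 lookup_delta by (cases "int m dvd j - (i + 1)") simp_all
    qed
  next
    case 2
    have ge: "Poly_Mapping.lookup (q + \<kappa>) (X l (i - 1)) \<noteq> 0" "Poly_Mapping.lookup (q + \<kappa>) (X l i) \<noteq> 0"
      unfolding 2 by (simp_all add: lookup_add)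
    from t show ?thesis
    proof (cases rule: T_cases)
      case (1 p j)
      from ge have pl: "p = l" unfolding 1 lookup_alpha by (auto split: if_splits)
      have "int m dvd j - (i - 1) \<or> int m dvd j + 1 - (i - 1)" "int m dvd j - i \<or> int m dvd j + 1 - i"
        using ge unfolding 1 lookup_alpha pl by (auto split: if_splits)
      \<comment> \<open>This excludes the term whose doubled variable has index \<open>i - 1\<close>
        and whose other variable has index \<open>i\<close>; it would make \<open>m\<close> divide
        2.\<close>
      moreover have "\<not> (int m dvd j + 1 - (i - 1) \<and> int m dvd j - i)"
        using dvd_diff[of "int m" "j + 1 - (i - 1)" "j - i"] small_dvd[of 2] by auto
      ultimately have "int m dvd j - (i - 1)" by (auto simp: algebra_simps)
      then have "q + \<kappa> = alpha l (i - 1)" using alpha_cong[of j "i - 1" l] 1 pl by simp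
      then show ?thesis using \<open>q = _\<close> by (simp add: alpha_def ac_simps)
    next
      case (2 j)
      have "int m dvd j - (i - 1)" "int m dvd j - i"
        using ge unfolding 2 lookup_delta by simp_all
      then have False using dvd_diff[of "int m" "j - (i - 1)" "j - i"] small_dvd[of 1] by simp
      then show ?thesis ..
    qed
  next
    case (3 p r)
    have ge: "Poly_Mapping.lookup (q + \<kappa>) (X p i) \<noteq> 0" "Poly_Mapping.lookup (q + \<kappa>) (X r i) \<noteq> 0"
      unfolding 3 by (simp_all add: lookup_add)
    from t show ?thesis
    proof (cases rule: T_cases)
      case (1 l' j)
      show ?thesis using ge 3 unfolding 1 lookup_alpha by (auto split: if_splits)
    next
      case (2 j)
      have "int m dvd j - i" using ge unfolding 2 lookup_delta by simp
      then have "q + \<kappa> = delta i" using delta_cong[of j i] 2 by simp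
      then show ?thesis using 3 delta_eq[of p r l i] by simp
    qed
  qed
  then show ?thesis by simp
qed

lemma qmon_T: "q \<in> qmon l i \<Longrightarrow> q + \<kappa> \<in> T \<longleftrightarrow> \<kappa> = sx l i"
  using qmon_complete qmon_unique by blast

lemma qmon_V: "q \<in> qmon l i \<Longrightarrow> q \<in> monoms_on V"
  by (auto simp: qmon_def)

definition quads :: "letter \<Rightarrow> int \<Rightarrow> (abc_var, 'k) mpoly set" where
  "quads l i = mon ` qmon l i"

lemma quads_next [simp]: "x l (i + 1) * x l (i + 1) \<in> quads l i"
  and quads_prev [simp]: "x l (i - 1) * x l i \<in> quads l i"
  and quads_letters: "p \<noteq> l \<Longrightarrow> r \<noteq> l \<Longrightarrow> p \<noteq> r \<Longrightarrow> x p i * x r i \<in> quads l i"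
  by (auto simp: quads_def qmon_def PVar_mon mon_add[symmetric])

lemma quads_square [simp]: "x l i * x l i \<in> quads l (i - 1)"
  using quads_next[of l "i - 1"] by simp

lemma quads_edge [simp]: "x l i * x l (i + 1) \<in> quads l (i + 1)"
  using quads_prev[of l "i + 1"] by simp

lemma quads_diff: "q \<in> quads l i \<Longrightarrow> q' \<in> quads l i \<Longrightarrow> q - q' \<in> I"
  by (auto simp: quads_def qmon_T qmon_V intro!: mon_diff_in_I)

lemma nadj_I:
  assumes "nadj y z" "y \<in> V" "z \<in> V"
  shows "PVar y * PVar z \<in> I"
proof -
  have "Poly_Mapping.single y 1 + Poly_Mapping.single z 1 + \<kappa> \<notin> T" for \<kappa>
    using T_nadj[of "Poly_Mapping.single y 1 + Poly_Mapping.single z 1 + \<kappa>" y z] assms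
    by (auto simp: keys_add_nat)
  then show ?thesis using assms mon_in_I unfolding PVar_mon mon_add[symmetric] by simp
qed

section \<open>Calculus modulo \<open>I2\<close>\<close>

lemma I_ideal: "ideal I (poly_ring V)"
  by (rule Ann_ideal)

lemma I2_ideal: "ideal I2 (poly_ring V)"
  using ring.ideal_prod_is_ideal[OF poly_ring_ring I_ideal I_ideal] .

lemma I2_prod: "p \<in> I \<Longrightarrow> q \<in> I \<Longrightarrow> p * q \<in> I2"
  using ideal_prod.prod[of p I q I "poly_ring V"] by simp

lemmas I2_add = ideal_add[OF I2_ideal] and I2_minus = ideal_minus[OF I2_ideal]
  and I2_mult = ideal_mult[OF I2_ideal]

lemma I2_cong: "p - q \<in> I2 \<Longrightarrow> p \<in> I2 \<longleftrightarrow> q \<in> I2"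
  using I2_add[of "p - q" q] I2_minus[of p "p - q"] by auto

lemma I2_trans: "p - q \<in> I2 \<Longrightarrow> q - r \<in> I2 \<Longrightarrow> p - r \<in> I2"
  using I2_add[of "p - q" "q - r"] by simp

lemma I2_sym: "p - q \<in> I2 \<Longrightarrow> q - p \<in> I2"
  using ideal_uminus[OF I2_ideal, of "p - q"] by simp

text \<open>Both pairs lie in \<open>I\<close>. The monomial enters through an equation so that its
  grouping into pairs can be verified by commutativity alone.\<close>

lemma nadj_nadj:
  assumes "nadj y z" "nadj u w" "y \<in> V" "z \<in> V" "u \<in> V" "w \<in> V" "p = PVar y * PVar z * (PVar u * PVar w)"
  shows "p \<in> I2"
  using assms nadj_I I2_prod by simp

text \<open>The basic move: the nonadjacent product and the difference of two quadrics with the same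
  contraction both lie in \<open>I\<close>.\<close>

lemma quads_swap:
  assumes "nadj y z" "y \<in> V" "z \<in> V" "q \<in> quads l i" "q' \<in> quads l i"
  shows "PVar y * PVar z * q - PVar y * PVar z * q' \<in> I2"
  using I2_prod[OF nadj_I[OF assms(1-3)] quads_diff[OF assms(4-5)]] by (simp add: right_diff_distrib)

lemma quads_zeroI:
  assumes "nadj y z" "y \<in> V" "z \<in> V" "q' \<in> quads l i" "PVar y * PVar z * q' \<in> I2" "q \<in> quads l i"
  shows "PVar y * PVar z * q \<in> I2"
  using quads_swap[OF assms(1-3,6,4)] assms(5) I2_cong by blast

text \<open>For the pair \<open>x l (i + 1)\<close>, \<open>x p i\<close>, no quadric in
  \<open>quads l i\<close> splits into partners nonadjacent to the two members, so one swap does not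
  suffice. A detour does: start from two nonadjacent pairs that both contain
  \<open>x p (i + 2)\<close>, swap its square for \<open>x l (i + 1) * x r (i + 1)\<close>, regroup,
  and swap the square of \<open>x r (i + 1)\<close> for \<open>x p i * x l i\<close>.\<close>

lemma quads_zero_chain:
  assumes d: "p \<noteq> l" "r \<noteq> l" "r \<noteq> p"
  shows "x l (i + 1) * x p i * (x l (i - 1) * x l i) \<in> I2"
proof -
  note n = nadj_iff small_dvd
  have "x l (i - 1) * x r (i + 1) * (x p (i + 2) * x p (i + 2)) \<in> I2"
    by (rule nadj_nadj[of "X l (i - 1)" "X p (i + 2)" "X r (i + 1)" "X p (i + 2)"])
      (simp_all only: X_in_V mult_ac, use d in \<open>simp_all add: n\<close>)
  then have "x l (i - 1) * x r (i + 1) * (x l (i + 1) * x r (i + 1)) \<in> I2"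
    using quads_next[of p "i + 1"] quads_letters[of l p r "i + 1"] d
    by - (rule quads_zeroI[where l = p and i = "i + 1" and q' = "x p (i + 2) * x p (i + 2)"]; simp add: n add.assoc)
  then have "x l (i + 1) * x l (i - 1) * (x r (i + 1) * x r (i + 1)) \<in> I2"
    by (simp only: mult_ac)
  then have "x l (i + 1) * x l (i - 1) * (x p i * x l i) \<in> I2"
    using quads_next[of r i] quads_letters[of p r l i] d
    by - (rule quads_zeroI[where l = r and i = i and q' = "x r (i + 1) * x r (i + 1)"]; simp add: n)
  then show ?thesis by (simp only: mult_ac)
qed

text \<open>The square of \<open>x l (i + 1)\<close> does not help when \<open>y\<close> is adjacent
  to that variable, so another quadric of \<open>quads l i\<close> is sought according to the
  positions of \<open>y\<close> and \<open>z\<close>.\<close>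

lemma quads_zero_next:
  assumes yz: "nadj y z" "y \<in> V" "z \<in> V" "y \<noteq> X l i" "z \<noteq> X l i" and adj: "\<not> nadj y (X l (i + 1))"
    and q: "q \<in> quads l i"
  shows "PVar y * PVar z * q \<in> I2"
proof -
  note n = nadj_iff small_dvd
  note reduce = quads_zeroI[OF yz(1-3) _ _ q]
  \<comment> \<open>It is enough to split some quadric of \<open>quads l i\<close> into factors
    \<open>u\<close>, \<open>w\<close> nonadjacent to \<open>y\<close> and \<open>z\<close>
    respectively.\<close>
  have pair: "PVar y * PVar z * q \<in> I2"
    if "nadj y u" "nadj z w" "u \<in> V" "w \<in> V" "PVar u * PVar w \<in> quads l i \<or> PVar w * PVar u \<in> quads l i" for u w
  proof -
    have "PVar y * PVar z * (PVar u * PVar w) \<in> I2"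
      by (rule nadj_nadj[of y u z w]) (use that yz in \<open>simp_all only: mult_ac\<close>)
    then show ?thesis using reduce[of "PVar u * PVar w"] reduce[of "PVar w * PVar u"] that(5)
      by (auto simp: mult_ac)
  qed
  \<comment> \<open>These are the neighbours of \<open>X l (i + 1)\<close>, itself included, except
    \<open>X l i\<close>.\<close>
  from adj consider "y = X l (i + 1)" | "y = X l (i + 2)" | p where "p \<noteq> l" "y = X p (i + 1)"
  proof (cases rule: adj_cases)
    case 1 then show ?thesis using that by blast
  next
    case 2 then show ?thesis using that by (simp add: add.assoc)
  next
    case 3 then show ?thesis using yz by simp
  next
    case 4 then show ?thesis using that by blast
  qed
  \<comment> \<open>Here \<open>y\<close> has the letter \<open>l\<close> and is nonadjacent to both
    other letters at index \<open>i\<close>. Their product works unless \<open>z\<close> is adjacent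
    to both of them, which puts \<open>z\<close> in the triangle at index \<open>i\<close>.\<close>
  moreover have same_letter: thesis
    if y: "y = X l (i + k)" and k: "1 \<le> k" "k \<le> 2"
      and z: "\<And>s. s \<noteq> l \<Longrightarrow> z = X s i \<Longrightarrow> thesis" and fin: "PVar y * PVar z * q \<in> I2 \<Longrightarrow> thesis" for k thesis
  proof -
    obtain p r where p: "p \<noteq> l" "r \<noteq> l" "r \<noteq> p" "\<And>q. q = l \<or> q = p \<or> q = r"
      using letter_othersE[of l] by metis
    have yn: "nadj y (X p i)" "nadj y (X r i)" using y k p by (simp_all add: n)
    consider "nadj z (X r i)" | "nadj z (X p i)" | "\<not> nadj z (X r i)" "\<not> nadj z (X p i)" by blast
    then show thesis
    proof cases
      case 1
      then show ?thesis using yn quads_letters[of p l r i] p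
        by (intro fin pair[of "X p i" "X r i"]) simp_all
    next
      case 2
      then show ?thesis using yn quads_letters[of p l r i] p
        by (intro fin pair[of "X r i" "X p i"]) simp_all
    next
      case 3
      from 3(2) show ?thesis
      proof (cases rule: adj_cases)
        case 1 then show ?thesis using p(1) by (intro z[of p])
      next
        case 2 then show ?thesis using 3(1) p by (simp add: n)
      next
        case 3 then show ?thesis using \<open>\<not> nadj z (X r i)\<close> p by (simp add: n)
      next
        case (4 s) then show ?thesis using yz(5) by (intro z[of s]) auto
      qed
    qed
  qed
  ultimately show ?thesis
  proof cases
    \<comment> \<open>Here \<open>y = X p (i + 1)\<close>. Either the product of the letters other
      than \<open>l\<close> works, or \<open>z\<close> is \<open>X p (i - 1)\<close> or
      \<open>X r i\<close> and the quadric \<open>x l (i - 1) * x l i\<close> does.\<close>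
    case y: 3
    obtain r where r: "r \<noteq> p" "r \<noteq> l" "\<And>q. q = p \<or> q = l \<or> q = r" using letter_thirdE[OF y(1)] by metis
    have q3: "x p i * x r i \<in> quads l i" using y r by (intro quads_letters) auto
    show ?thesis
    proof (cases "nadj z (X p i)")
      case True
      then show ?thesis using q3 y r by (intro pair[of "X r i" "X p i"]) (simp_all add: n)
    next
      case False
      then show ?thesis
      proof (cases rule: adj_cases)
        case 1 then show ?thesis using yz(1) y by (simp add: n)
      next
        case 2 then show ?thesis using yz(1) y by (simp add: n)
      next
        case 3
        then show ?thesis using y by (intro pair[of "X l (i - 1)" "X l i"]) (simp_all add: n)
      next
        case (4 s)
        then have "s = r" using r(3)[of s] yz(5) by auto
        then show ?thesis using y r 4 by (intro pair[of "X l i" "X l (i - 1)"]) (simp_all add: n)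
      qed
    qed
  next
    case y: 1
    then show ?thesis
    proof (rule same_letter)
      fix s assume s: "s \<noteq> l" "z = X s i"
      obtain r where "r \<noteq> s" "r \<noteq> l" using letter_thirdE[OF s(1)] by metis
      \<comment> \<open>This position needs the detour of \<open>quads_zero_chain\<close>.\<close>
      then have "PVar y * PVar z * (x l (i - 1) * x l i) \<in> I2"
        using quads_zero_chain[of s l r i] s y by simp
      from reduce[OF quads_prev this] show ?thesis .
    qed simp_all
  next
    case y: 2
    then show ?thesis
    proof (rule same_letter)
      fix s assume "s \<noteq> l" "z = X s i"
      then show ?thesis using y by (intro pair[of "X l i" "X l (i - 1)"]) (simp_all add: n)
    qed simp_all
  qed
qed

text \<open>If neither \<open>y\<close> nor \<open>z\<close> is adjacent to
  \<open>X l (i + 1)\<close>, the square of that variable gives two nonadjacent pairs; otherwise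
  \<open>quads_zero_next\<close> applies, after exchanging \<open>y\<close> and \<open>z\<close> if
  necessary.\<close>

lemma quads_zero:
  assumes yz: "nadj y z" "y \<in> V" "z \<in> V" "y \<noteq> X l i" "z \<noteq> X l i" and q: "q \<in> quads l i"
  shows "PVar y * PVar z * q \<in> I2"
proof -
  consider "\<not> nadj y (X l (i + 1))" | "\<not> nadj z (X l (i + 1))"
    | "nadj y (X l (i + 1))" "nadj z (X l (i + 1))" by blast
  then show ?thesis
  proof cases
    case 1 then show ?thesis using quads_zero_next yz q by blast
  next
    case 2
    have "nadj z y" using yz(1) nadj_sym by blast
    then have "PVar z * PVar y * q \<in> I2" using quads_zero_next 2 yz q by blast
    then show ?thesis by (simp only: mult_ac)
  next
    case 3
    then have "PVar y * PVar z * (x l (i + 1) * x l (i + 1)) \<in> I2"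
      by (intro nadj_nadj[of y "X l (i + 1)" z "X l (i + 1)"]) (use yz in \<open>simp_all only: mult_ac X_in_V\<close>)
    then show ?thesis using quads_zeroI[OF yz(1-3) quads_next _ q] by blast
  qed
qed

section \<open>Comparing the classes of a variable times a term of the cubic\<close>

definition alpha_poly :: "letter \<Rightarrow> int \<Rightarrow> (abc_var, 'k) mpoly" where
  "alpha_poly l i = x l i * (x l (i + 1) * x l (i + 1))"

definition delta_poly :: "int \<Rightarrow> (abc_var, 'k) mpoly" where
  "delta_poly i = x LA i * (x LB i * x LC i)"

lemma alpha_poly_mon: "alpha_poly l i = mon (alpha l i)"
  by (simp only: alpha_poly_def alpha_def mon_add PVar_mon mult.assoc)

lemma delta_poly_eq: "l \<noteq> p \<Longrightarrow> l \<noteq> r \<Longrightarrow> p \<noteq> r \<Longrightarrow> delta_poly i = x l i * (x p i * x r i)"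
  by (cases l; cases p; cases r) (simp_all add: delta_poly_def mult_ac)

lemma swap_at:
  assumes "nadj (X l i) (X p j)" "q \<in> quads p j" "q' \<in> quads p j"
  shows "x l i * (x p j * q) - x l i * (x p j * q') \<in> I2"
  using quads_swap[OF assms(1) _ _ assms(2,3)] by (simp add: mult.assoc)

text \<open>Two terms on the cycle of \<open>p\<close> share the variable \<open>X p j\<close>;
  swapping the quadrics they provide for it moves from one term to the other. The walk round the
  cycle begins at index \<open>i\<close> and takes at most \<open>m - 1\<close> steps.\<close>

lemma alpha_poly_same:
  assumes "p \<noteq> l" "k < m"
  shows "x l i * alpha_poly p (i + int k) - x l i * alpha_poly p i \<in> I2"
  using assms(2)
proof (induction k)
  case 0 then show ?case using ideal_zero[OF I2_ideal] by simp
next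
  case (Suc k)
  let ?j = "i + int k + 1"
  \<comment> \<open>The walk must not pivot at \<open>X p i\<close>, the one variable of letter
    \<open>p\<close> adjacent to \<open>X l i\<close>; \<open>Suc k < m\<close> prevents
    this.\<close>
  have "\<not> int m dvd int k + 1" using Suc.prems by (auto dest!: zdvd_imp_le)
  then have "nadj (X l i) (X p ?j)"
    using assms(1) dvd_minus_iff[of "int m" "int k + 1"] by (simp add: nadj_iff)
  from swap_at[OF this quads_next quads_prev]
  have "x l i * alpha_poly p ?j - x l i * alpha_poly p (i + int k) \<in> I2"
    by (simp add: alpha_poly_def mult.left_commute)
  moreover have "x l i * alpha_poly p (i + int k) - x l i * alpha_poly p i \<in> I2"
    using Suc by simp
  moreover have "i + int (Suc k) = ?j" by simp
  ultimately show ?case using I2_trans by metis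
qed

lemma alpha_poly_any:
  assumes "p \<noteq> l" shows "x l i * alpha_poly p j - x l i * alpha_poly p i \<in> I2"
proof -
  obtain k where k: "k < m" "int m dvd (j - i) - int k" using int_mod_rep by blast
  have "alpha_poly p j = alpha_poly p (i + int k)"
    unfolding alpha_poly_mon using alpha_cong[of j "i + int k" p] k(2) by (simp add: algebra_simps)
  then show ?thesis using alpha_poly_same[OF assms k(1)] by simp
qed

lemma quads_other_letter:
  assumes "p \<noteq> l" "nadj (X l i) (X p j)" "q \<in> quads p j"
  shows "x l i * (x p j * q) - x l i * alpha_poly p i \<in> I2"
  using swap_at[OF assms(2,3) quads_next] alpha_poly_any[OF assms(1)] unfolding alpha_poly_def by (rule I2_trans)

lemma delta_poly_other_letter:
  assumes "p \<noteq> l" "nadj (X l i) (X p j)"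
  shows "x l i * delta_poly j - x l i * alpha_poly p i \<in> I2"
proof -
  obtain r where r: "r \<noteq> l" "r \<noteq> p" using letter_thirdE[of l p] assms(1) by metis
  show ?thesis
    using quads_other_letter[OF assms quads_letters[of l p r]] r assms(1) delta_poly_eq[of p l r j] by simp
qed

text \<open>Both products are congruent to \<open>x l i * delta_poly (i + 1)\<close>, which links
  the cycles of two letters.\<close>

lemma alpha_poly_letters:
  assumes "p \<noteq> l" "r \<noteq> l"
  shows "x l i * alpha_poly p i - x l i * alpha_poly r i \<in> I2"
proof -
  have "nadj (X l i) (X p (i + 1))" "nadj (X l i) (X r (i + 1))"
    using assms by (simp_all add: nadj_iff small_dvd)
  from delta_poly_other_letter[OF assms(1) this(1)] delta_poly_other_letter[OF assms(2) this(2)]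
  show ?thesis by (meson I2_sym I2_trans)
qed

text \<open>For \<open>p\<close> different from \<open>l\<close> this is the walk along a cycle
  followed by a change of letter. If \<open>p = l\<close>, swapping to the quadric in the other two
  letters produces a \<open>delta_poly\<close>, which can be regrouped around
  \<open>x r j\<close>.\<close>

lemma quads_nadj:
  assumes "nadj (X l i) (X p j)" "q \<in> quads p j" "r \<noteq> l"
  shows "x l i * (x p j * q) - x l i * alpha_poly r i \<in> I2"
proof (cases "p = l")
  case False
  then show ?thesis using quads_other_letter[OF _ assms(1,2)] alpha_poly_letters[OF _ assms(3)] I2_trans by blast
next
  case True
  obtain s where s: "s \<noteq> l" "s \<noteq> r" using letter_thirdE[of l r] assms(3) by metis
  have "x l i * (x p j * q) - x l i * delta_poly j \<in> I2"
    using swap_at[OF assms(1,2) quads_letters[of r p s]] s True assms(3) delta_poly_eq[of l r s j] by simp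
  moreover have "nadj (X l i) (X r j)" using assms(1,3) True by (simp add: nadj_iff)
  ultimately show ?thesis using delta_poly_other_letter[OF assms(3)] I2_trans by blast
qed

text \<open>A representative of the class \<open>z t\<close> of the overview, with \<open>t\<close>
  on the cycle of another letter. The variable \<open>y\<close> of \<open>V\<close> has exponent 1
  in \<open>mu y\<close>, so that its pairing with \<open>phi y\<close> is 1 in every
  characteristic.\<close>

definition mu :: "abc_var \<Rightarrow> abc_var monom" where
  "mu y = Poly_Mapping.single y 1 + alpha (other_letter y) (var_index y)"

lemma other_letter_X [simp]: "other_letter (X l i) \<noteq> l"
  by (cases l) (simp_all add: cvar.simps)

lemma mu_X: "mu (X l i) = sx l i + alpha (other_letter (X l i)) i"
proof -
  have "var_index (X l i) = i mod int m" using m by (cases l) (simp_all add: cvar.simps)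
  moreover have "int m dvd i mod int m - i" by (simp add: mod_eq_dvd_iff[symmetric])
  ultimately show ?thesis using alpha_cong[of "i mod int m" i] by (simp add: mu_def)
qed

lemma mon_mu: "mon (mu (X l i)) = x l i * alpha_poly (other_letter (X l i)) i"
  by (simp only: mu_X mon_add PVar_mon alpha_poly_mon)

lemma mu_deg: "mdeg (mu y) = 4"
  by (simp add: mu_def mdeg_add alpha_def)

lemma mu_V: "y \<in> V \<Longrightarrow> mu y \<in> monoms_on V"
  by (simp add: mu_def alpha_def)

text \<open>Adjacent variables occur together in a term of \<open>F\<close>, and their product is a
  quadric of the remaining variable.\<close>

lemma adj_quads:
  assumes "\<not> nadj u w" "u \<in> V" "w \<in> V"
  obtains l i where "PVar u * PVar w \<in> quads l i"
proof -
  obtain l i where w: "w = X l i" using assms V_cases by blast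
  from assms(1)[unfolded w] show ?thesis
  proof (cases rule: adj_cases)
    case 1 then show ?thesis using that[of l "i - 1"] w by simp
  next
    case 2 then show ?thesis using that[of l "i + 1"] w by (simp add: mult.commute[of "x l (i + 1)"])
  next
    case 3 then show ?thesis using that[of l i] w by simp
  next
    case (4 p)
    then obtain r where "r \<noteq> p" "r \<noteq> l" using letter_thirdE[of p l] by metis
    then show ?thesis using that[of r i] w 4 quads_letters[of p r l i] by simp
  qed
qed

section \<open>Spanning in degree 4: quartics with a nonadjacent pair\<close>

abbreviation W :: "(abc_var, 'k) mpoly set" where "W \<equiv> ideal_span V I2 V (\<lambda>y. mon (mu y))"

lemma I2_W: "p \<in> I2 \<Longrightarrow> p \<in> W"
  by (rule ideal_span_ideal[OF I2_ideal])

lemma nadj_quads_W: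
  assumes "nadj (X l i) (X p j)" "q \<in> quads p j"
  shows "x l i * x p j * q \<in> W"
proof -
  have "x l i * x p j * q - mon (mu (X l i)) \<in> I2"
    unfolding mon_mu using quads_nadj[OF assms other_letter_X] by (simp add: mult.assoc)
  then show ?thesis
    by (rule ideal_span_cong[OF I2_ideal]) (rule ideal_span_generator[OF I2_ideal V_finite], simp)
qed

text \<open>The two remaining factors either form a second nonadjacent pair or are a quadric of some
  variable. If that variable belongs to the pair, the class is that of a \<open>mu\<close>; if not,
  \<open>quads_zero\<close> applies.\<close>

lemma nadj_W:
  assumes "nadj y z" "y \<in> V" "z \<in> V" "u \<in> V" "w \<in> V" and p: "p = PVar y * PVar z * (PVar u * PVar w)"
  shows "p \<in> W"
proof (cases "nadj u w")
  case True
  then show ?thesis using nadj_nadj I2_W assms by blast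
next
  case False
  then obtain l i where q: "PVar u * PVar w \<in> quads l i" using adj_quads assms by blast
  obtain l1 i1 l2 i2 where X: "y = X l1 i1" "z = X l2 i2" using V_cases assms(2,3) by metis
  consider "z = X l i" | "y = X l i" | "y \<noteq> X l i" "z \<noteq> X l i" by blast
  then show ?thesis
  proof cases
    case 1 then show ?thesis using nadj_quads_W assms q X p by blast
  next
    case 2
    then have "nadj z (X l i)" using nadj_sym assms(1) by blast
    then have "PVar z * PVar (X l i) * (PVar u * PVar w) \<in> W"
      using nadj_quads_W[OF _ q] unfolding X(2) by blast
    then show ?thesis unfolding p 2 by (simp only: mult_ac)
  next
    case 3
    then show ?thesis using quads_zero[OF assms(1-3) _ _ q] I2_W p by blast
  qed
qed

text \<open>A product of two differences of quadrics lies in \<open>I\<^sup>2\<close>, so one of its four terms is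
  controlled by the other three.\<close>

lemma cross_W:
  assumes "q1 \<in> quads l i" "q2 \<in> quads l i" "q1' \<in> quads p j" "q2' \<in> quads p j"
    and "q1 * q2' \<in> W" "q2 * q1' \<in> W" "q2 * q2' \<in> W" "s = q1 * q1'"
  shows "s \<in> W"
proof -
  have "s = (q1 - q2) * (q1' - q2') + q1 * q2' + q2 * q1' - q2 * q2'"
    using assms(8) by (simp add: algebra_simps)
  moreover have "(q1 - q2) * (q1' - q2') \<in> W"
    by (intro I2_W I2_prod quads_diff[OF assms(1,2)] quads_diff[OF assms(3,4)])
  ultimately show ?thesis
    using assms(5-7) ideal_span_closed[OF I2_ideal] by metis
qed

lemma nadj_X_W:
  assumes "nadj (X l i) (X p j)" "s = x l i * x p j * (x l1 i1 * x l2 i2)"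
  shows "s \<in> W"
  using nadj_W[OF assms(1)] assms(2) by simp

section \<open>Quartics supported on a triangle or on an edge of a cycle\<close>

context
  fixes l p r :: letter
  assumes d: "p \<noteq> l" "r \<noteq> l" "r \<noteq> p"
begin

lemma distinct_letters: "l \<noteq> p" "l \<noteq> r" "p \<noteq> r" "p \<noteq> l" "r \<noteq> l" "r \<noteq> p"
  using d by auto

text \<open>The names in this group write a, b, c for \<open>x l i\<close>, \<open>x p i\<close>,
  \<open>x r i\<close>. The quartic is read as a product of two quadrics, here ab and ac, and their
  replacements are chosen so that each of the other three products in \<open>cross_W\<close>
  contains a nonadjacent pair.\<close>

lemma W_aabc: "x l i * x l i * (x p i * x r i) \<in> W"
proof (rule cross_W)
  show "x l i * x p i \<in> quads r i" "x l i * x r i \<in> quads p i" by (simp_all add: quads_letters distinct_letters)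
  show "x r (i + 1) * x r (i + 1) \<in> quads r i" "x p (i - 1) * x p i \<in> quads p i" by simp_all
  show "x l i * x p i * (x p (i - 1) * x p i) \<in> W"
    by (rule nadj_X_W[of l i p "i - 1" _ p i p i], simp add: nadj_iff distinct_letters, simp only: mult_ac)
  show "x r (i + 1) * x r (i + 1) * (x l i * x r i) \<in> W"
    by (rule nadj_X_W[of r "i + 1" l i _ r "i + 1" r i], simp add: nadj_iff distinct_letters, simp only: mult_ac)
  show "x r (i + 1) * x r (i + 1) * (x p (i - 1) * x p i) \<in> W"
    by (rule nadj_X_W[of r "i + 1" p i _ r "i + 1" p "i - 1"], simp add: nadj_iff distinct_letters, simp only: mult_ac)
qed (simp only: mult_ac)

text \<open>Both factors are the same square but need different replacements: the square of either
  replacement would again have pairwise adjacent variables.\<close>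

lemma W_aaaa: "x l i * x l i * (x l i * x l i) \<in> W"
proof (rule cross_W[of "x l i * x l i" l "i - 1" "x p (i - 1) * x r (i - 1)"
      "x l i * x l i" l "i - 1" "x l (i - 2) * x l (i - 1)"])
  show "x l i * x l i \<in> quads l (i - 1)" "x l i * x l i \<in> quads l (i - 1)" by simp_all
  show "x p (i - 1) * x r (i - 1) \<in> quads l (i - 1)" by (simp add: quads_letters distinct_letters)
  show "x l (i - 2) * x l (i - 1) \<in> quads l (i - 1)" using quads_prev[of l "i - 1"] by simp
  show "x l i * x l i * (x l (i - 2) * x l (i - 1)) \<in> W"
    by (rule nadj_X_W[of l i l "i - 2" _ l i l "i - 1"], simp add: nadj_iff distinct_letters small_dvd, simp only: mult_ac)
  show "x p (i - 1) * x r (i - 1) * (x l i * x l i) \<in> W"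
    by (rule nadj_X_W[of p "i - 1" l i _ r "i - 1" l i], simp add: nadj_iff distinct_letters, simp only: mult_ac)
  show "x p (i - 1) * x r (i - 1) * (x l (i - 2) * x l (i - 1)) \<in> W"
    by (rule nadj_X_W[of p "i - 1" l "i - 2" _ r "i - 1" l "i - 1"], simp add: nadj_iff distinct_letters, simp only: mult_ac)
qed simp

lemma W_aaab: "x l i * x l i * (x l i * x p i) \<in> W"
proof (rule cross_W)
  show "x l i * x l i \<in> quads l (i - 1)" by simp
  show "x p (i - 1) * x r (i - 1) \<in> quads l (i - 1)" by (simp add: quads_letters distinct_letters)
  show "x l i * x p i \<in> quads r i" by (simp add: quads_letters distinct_letters)
  show "x r (i + 1) * x r (i + 1) \<in> quads r i" by simp
  show "x l i * x l i * (x r (i + 1) * x r (i + 1)) \<in> W"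
    by (rule nadj_X_W[of l i r "i + 1" _ l i r "i + 1"], simp add: nadj_iff distinct_letters, simp only: mult_ac)
  show "x p (i - 1) * x r (i - 1) * (x l i * x p i) \<in> W"
    by (rule nadj_X_W[of p "i - 1" l i _ r "i - 1" p i], simp add: nadj_iff distinct_letters, simp only: mult_ac)
  show "x p (i - 1) * x r (i - 1) * (x r (i + 1) * x r (i + 1)) \<in> W"
    by (rule nadj_X_W[of p "i - 1" r "i + 1" _ r "i - 1" r "i + 1"], simp add: nadj_iff distinct_letters small_dvd, simp only: mult_ac)
qed simp

lemma W_aabb: "x l i * x l i * (x p i * x p i) \<in> W"
proof (rule cross_W)
  show "x l i * x l i \<in> quads l (i - 1)" by simp
  show "x p (i - 1) * x r (i - 1) \<in> quads l (i - 1)" by (simp add: quads_letters distinct_letters)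
  show "x p i * x p i \<in> quads p (i - 1)" by simp
  show "x p (i - 2) * x p (i - 1) \<in> quads p (i - 1)" using quads_prev[of p "i - 1"] by simp
  show "x l i * x l i * (x p (i - 2) * x p (i - 1)) \<in> W"
    by (rule nadj_X_W[of l i p "i - 2" _ l i p "i - 1"], simp add: nadj_iff distinct_letters small_dvd, simp only: mult_ac)
  show "x p (i - 1) * x r (i - 1) * (x p i * x p i) \<in> W"
    by (rule nadj_X_W[of r "i - 1" p i _ p "i - 1" p i], simp add: nadj_iff distinct_letters, simp only: mult_ac)
  show "x p (i - 1) * x r (i - 1) * (x p (i - 2) * x p (i - 1)) \<in> W"
    by (rule nadj_X_W[of r "i - 1" p "i - 2" _ p "i - 1" p "i - 1"], simp add: nadj_iff distinct_letters, simp only: mult_ac)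
qed simp

lemma W_aaa_next: "x l i * x l i * (x l i * x l (i + 1)) \<in> W"
proof (rule cross_W)
  show "x l i * x l i \<in> quads l (i - 1)" by simp
  show "x p (i - 1) * x r (i - 1) \<in> quads l (i - 1)" by (simp add: quads_letters distinct_letters)
  show "x l i * x l (i + 1) \<in> quads l (i + 1)" by simp
  show "x p (i + 1) * x r (i + 1) \<in> quads l (i + 1)" by (simp add: quads_letters distinct_letters)
  show "x l i * x l i * (x p (i + 1) * x r (i + 1)) \<in> W"
    by (rule nadj_X_W[of l i p "i + 1" _ l i r "i + 1"], simp add: nadj_iff distinct_letters, simp only: mult_ac)
  show "x p (i - 1) * x r (i - 1) * (x l i * x l (i + 1)) \<in> W"
    by (rule nadj_X_W[of p "i - 1" l i _ r "i - 1" l "i + 1"], simp add: nadj_iff distinct_letters, simp only: mult_ac)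
  show "x p (i - 1) * x r (i - 1) * (x p (i + 1) * x r (i + 1)) \<in> W"
    by (rule nadj_X_W[of p "i - 1" r "i + 1" _ r "i - 1" p "i + 1"], simp add: nadj_iff distinct_letters small_dvd, simp only: mult_ac)
qed simp

text \<open>Here, and in the next lemma at index \<open>i + 1\<close>, one of the mixed products has
  no nonadjacent pair and is supplied by \<open>W_aabc\<close>.\<close>

lemma W_aa_next_next: "x l i * x l i * (x l (i + 1) * x l (i + 1)) \<in> W"
proof (rule cross_W)
  show "x l i * x l i \<in> quads l (i - 1)" by simp
  show "x p (i - 1) * x r (i - 1) \<in> quads l (i - 1)" by (simp add: quads_letters distinct_letters)
  show "x l (i + 1) * x l (i + 1) \<in> quads l i" by simp
  show "x p i * x r i \<in> quads l i" by (simp add: quads_letters distinct_letters)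
  show "x l i * x l i * (x p i * x r i) \<in> W" by (rule W_aabc)
  show "x p (i - 1) * x r (i - 1) * (x l (i + 1) * x l (i + 1)) \<in> W"
    by (rule nadj_X_W[of p "i - 1" l "i + 1" _ r "i - 1" l "i + 1"], simp add: nadj_iff distinct_letters small_dvd, simp only: mult_ac)
  show "x p (i - 1) * x r (i - 1) * (x p i * x r i) \<in> W"
    by (rule nadj_X_W[of p "i - 1" r i _ r "i - 1" p i], simp add: nadj_iff distinct_letters, simp only: mult_ac)
qed simp

lemma W_a_next_next_next: "x l i * x l (i + 1) * (x l (i + 1) * x l (i + 1)) \<in> W"
proof (rule cross_W)
  show "x l (i + 1) * x l (i + 1) \<in> quads l i" by simp
  show "x p i * x r i \<in> quads l i" by (simp add: quads_letters distinct_letters)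
  show "x l i * x l (i + 1) \<in> quads l (i + 1)" by simp
  show "x p (i + 1) * x r (i + 1) \<in> quads l (i + 1)" by (simp add: quads_letters distinct_letters)
  show "x l (i + 1) * x l (i + 1) * (x p (i + 1) * x r (i + 1)) \<in> W" by (rule W_aabc)
  show "x p i * x r i * (x l i * x l (i + 1)) \<in> W"
    by (rule nadj_X_W[of p i l "i + 1" _ r i l i], simp add: nadj_iff distinct_letters, simp only: mult_ac)
  show "x p i * x r i * (x p (i + 1) * x r (i + 1)) \<in> W"
    by (rule nadj_X_W[of p i r "i + 1" _ r i p "i + 1"], simp add: nadj_iff distinct_letters, simp only: mult_ac)
qed (simp only: mult_ac)

end

lemma two_var_products:
  fixes a b :: "'r::comm_monoid_mult"
  assumes "a * a * (a * a) \<in> S" "a * a * (a * b) \<in> S" "a * a * (b * b) \<in> S" "a * b * (b * b) \<in> S" "b * b * (b * b) \<in> S"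
    and "{y, z, u, w} \<subseteq> {a, b}"
  shows "y * z * (u * w) \<in> S"
  using assms by (auto simp: mult_ac)

text \<open>There are fifteen quartic monomials in three variables, and commutativity brings every
  product into one of these forms.\<close>

lemma three_var_products:
  fixes a b c :: "'r::comm_monoid_mult"
  assumes "a * a * (a * a) \<in> S" "b * b * (b * b) \<in> S" "c * c * (c * c) \<in> S"
    "a * a * (a * b) \<in> S" "a * a * (a * c) \<in> S" "b * b * (b * a) \<in> S" "b * b * (b * c) \<in> S"
    "c * c * (c * a) \<in> S" "c * c * (c * b) \<in> S"
    "a * a * (b * b) \<in> S" "a * a * (c * c) \<in> S" "b * b * (c * c) \<in> S"
    "a * a * (b * c) \<in> S" "b * b * (a * c) \<in> S" "c * c * (a * b) \<in> S"
    and "{y, z, u, w} \<subseteq> {a, b, c}"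
  shows "y * z * (u * w) \<in> S"
  using assms by (auto simp: mult_ac)

lemma edge_W:
  assumes "{y, z, u, w} \<subseteq> {X l i, X l (i + 1)}"
  shows "PVar y * PVar z * (PVar u * PVar w) \<in> W"
proof -
  obtain p r where d: "p \<noteq> l" "r \<noteq> l" "r \<noteq> p" using letter_othersE[of l] by metis
  show ?thesis
    by (rule two_var_products[OF W_aaaa[OF d, where i = i] W_aaa_next[OF d, where i = i] W_aa_next_next[OF d, where i = i]
        W_a_next_next_next[OF d, where i = i] W_aaaa[OF d, where i = "i + 1"]]) (use image_mono[OF assms, of PVar] in simp)
qed

lemma triangle_W:
  assumes d: "p \<noteq> l" "r \<noteq> l" "r \<noteq> p" and s: "{y, z, u, w} \<subseteq> {X l i, X p i, X r i}"
  shows "PVar y * PVar z * (PVar u * PVar w) \<in> W"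
proof -
  have neq: "l \<noteq> p" "p \<noteq> l" "l \<noteq> r" "r \<noteq> l" "p \<noteq> r" "r \<noteq> p" using d by auto
  show ?thesis
    using W_aaaa[OF neq(2,4,6), of i] W_aaaa[OF neq(1,6,4), of i] W_aaaa[OF neq(3,5,2), of i]
      W_aaab[OF neq(2,4,6), of i] W_aaab[OF neq(4,2,5), of i] W_aaab[OF neq(1,6,4), of i]
      W_aaab[OF neq(6,1,3), of i] W_aaab[OF neq(3,5,2), of i] W_aaab[OF neq(5,3,1), of i]
      W_aabb[OF neq(2,4,6), of i] W_aabb[OF neq(4,2,5), of i] W_aabb[OF neq(6,1,3), of i]
      W_aabc[OF neq(2,4,6), of i] W_aabc[OF neq(1,6,4), of i] W_aabc[OF neq(3,5,2), of i]
      image_mono[OF s, of PVar, unfolded image_insert image_empty]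
    by (rule three_var_products)
qed

text \<open>An edge of a cycle lies in no triangle of the graph: \<open>m\<close> is larger than 3,
  and neighbours with another letter have the same index.\<close>

lemma adj_edge:
  assumes "\<not> nadj v (X l i)" "\<not> nadj v (X l (i + 1))"
  shows "v \<in> {X l i, X l (i + 1)}"
  using assms(1)
proof (cases rule: adj_cases)
  case 3 then show ?thesis using assms(2) by (simp add: nadj_iff small_dvd)
next
  case 4 then show ?thesis using assms(2) by (auto simp: nadj_iff)
qed simp_all

text \<open>A quartic without nonadjacent pairs is supported on a clique, and every clique lies in
  an edge of a cycle or in the triangle at one index.\<close>

lemma degree4_W:
  assumes V: "y \<in> V" "z \<in> V" "u \<in> V" "w \<in> V"
  shows "PVar y * PVar z * (PVar u * PVar w) \<in> W"
proof (cases "nadj y z \<or> nadj y u \<or> nadj y w \<or> nadj z u \<or> nadj z w \<or> nadj u w")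
  case True
  have n: "PVar y * PVar z * (PVar u * PVar w) \<in> W"
    if "nadj a b" "{a, b, c, e} \<subseteq> V" "PVar y * PVar z * (PVar u * PVar w) = (PVar a * PVar b * (PVar c * PVar e) :: (abc_var, 'k) mpoly)"
    for a b c e
    using nadj_W[OF that(1) _ _ _ _ that(3)] that(2) by simp
  from True show ?thesis
    by - (elim disjE; (rule n[of y z u w] n[of y u z w] n[of y w z u] n[of z u y w] n[of z w y u] n[of u w y z];
      (assumption | use V in blast | simp only: mult_ac)))
next
  case False
  obtain l i where y: "y = X l i" using V V_cases by blast
  have adj: "\<not> nadj a b" if "a \<in> {y, z, u, w}" "b \<in> {y, z, u, w}" "a \<noteq> b" for a b
    using that False nadj_sym by auto
  \<comment> \<open>Repeated factors are covered too, as a variable is adjacent to itself.\<close>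
  have adj': "\<not> nadj a b" if "a \<in> {y, z, u, w}" "b \<in> {y, z, u, w}" for a b
  proof (cases "a = b")
    case True
    have "a \<in> V" using V that by blast
    then obtain p j where "a = X p j" by (rule V_cases)
    then show ?thesis unfolding True[symmetric] by (simp add: nadj_iff)
  qed (use adj that in blast)
  have yi: "X l i \<in> {y, z, u, w}" unfolding y by (rule insertI1)
  consider "X l (i + 1) \<in> {y, z, u, w}" | "X l (i - 1) \<in> {y, z, u, w}"
    | "X l (i + 1) \<notin> {y, z, u, w}" "X l (i - 1) \<notin> {y, z, u, w}" by blast
  then show ?thesis
  proof cases
    case 1
    have "v \<in> {X l i, X l (i + 1)}" if "v \<in> {y, z, u, w}" for v
      by (rule adj_edge[OF adj'[OF that yi] adj'[OF that 1]])
    then show ?thesis by (intro edge_W[of _ _ _ _ l i] subsetI)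
  next
    case 2
    have "v \<in> {X l (i - 1), X l (i - 1 + 1)}" if "v \<in> {y, z, u, w}" for v
      using adj_edge[OF adj'[OF that 2]] adj'[OF that yi] by (simp only: diff_add_cancel not_False_eq_True)
    then show ?thesis by (intro edge_W[of _ _ _ _ l "i - 1"] subsetI)
  next
    case 3
    obtain p r where d: "p \<noteq> l" "r \<noteq> l" "r \<noteq> p" "\<And>q. q = l \<or> q = p \<or> q = r"
      using letter_othersE[of l] by metis
    have "v \<in> {X l i, X p i, X r i}" if v: "v \<in> {y, z, u, w}" for v
    proof -
      have "\<not> nadj v (X l i)" by (rule adj'[OF v yi])
      then show ?thesis
      proof (cases rule: adj_cases)
        case 2 then show ?thesis using 3 v by blast
      next
        case 3 then show ?thesis using \<open>X l (i - 1) \<notin> _\<close> v by blast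
      next
        case (4 q) then show ?thesis using d(4)[of q] by auto
      qed simp
    qed
    then show ?thesis by (intro triangle_W[OF d(1-3)] subsetI)
  qed
qed

text \<open>By \<open>alpha_poly_any\<close> the term in \<open>mu y\<close> may be moved to any
  index \<open>j\<close> of its cycle. For a suitable \<open>j\<close> its single variable is
  nonadjacent to \<open>s\<close> and its doubled one is nonadjacent to \<open>y\<close>, which
  gives two factors in \<open>I\<close>.\<close>

lemma mult_mu_I2:
  assumes "s \<in> V" "y \<in> V"
  shows "PVar s * mon (mu y) \<in> I2"
proof -
  obtain q k l i where s: "s = X q k" and y: "y = X l i" using V_cases assms by metis
  let ?p = "other_letter (X l i)"
  \<comment> \<open>Both \<open>k + 2\<close> and \<open>k + 3\<close> are far enough from the index
    \<open>k\<close> of \<open>s\<close>, whatever its letter. The choice keeps \<open>j + 1\<close>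
    from being congruent to \<open>i\<close>, where \<open>y\<close> would be adjacent.\<close>
  define j where "j = (if int m dvd k + 3 - i then k + 3 else k + 2)"
  have "nadj s (X ?p j)" unfolding s j_def by (simp add: nadj_iff small_dvd)
  moreover have "nadj y (X ?p (j + 1))"
  proof -
    have "\<not> int m dvd i - (j + 1)"
    proof
      assume "int m dvd i - (j + 1)"
      then have *: "int m dvd j + 1 - i" by (subst dvd_diff_commute)
      show False
      proof (cases "int m dvd k + 3 - i")
        case True
        from dvd_diff[OF * True] have "int m dvd 1" using True by (simp add: j_def)
        then show False using small_dvd[of 1] by simp
      next
        case False
        then show False using * by (simp add: j_def add.assoc)
      qed
    qed
    then show ?thesis using other_letter_X[of l i] unfolding y nadj_iff by metis
  qed
  ultimately have "PVar s * x ?p j * (x l i * x ?p (j + 1)) \<in> I2"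
    using assms y by (intro I2_prod nadj_I) simp_all
  then have "x ?p (j + 1) * (PVar s * x ?p j * (x l i * x ?p (j + 1))) \<in> I2"
    by (rule I2_mult) simp
  then have "PVar s * (x l i * alpha_poly ?p j) \<in> I2"
    unfolding alpha_poly_def by (simp only: mult_ac)
  moreover have "PVar s * (x l i * alpha_poly ?p j - x l i * alpha_poly ?p i) \<in> I2"
    using alpha_poly_any[OF other_letter_X] assms by (intro I2_mult) simp_all
  ultimately show ?thesis
    unfolding y mon_mu by (simp add: right_diff_distrib I2_cong)
qed

lemma mult_W_I2:
  assumes "s \<in> V" "q \<in> W"
  shows "PVar s * q \<in> I2"
proof -
  obtain c where c: "q - (\<Sum>y\<in>V. PConst (c y) * mon (mu y)) \<in> I2"
    using assms(2) by (auto simp: ideal_span_def)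
  have "PVar s * (q - (\<Sum>y\<in>V. PConst (c y) * mon (mu y))) \<in> I2"
    by (rule I2_mult[OF c]) (simp add: assms)
  moreover have "(\<Sum>y\<in>V. PConst (c y) * (PVar s * mon (mu y))) \<in> I2"
    by (rule ideal_sum[OF I2_ideal], rule I2_mult[OF mult_mu_I2]) (simp_all add: assms)
  ultimately show ?thesis
    by (simp add: right_diff_distrib sum_distrib_left mult.left_commute I2_cong)
qed

lemma mon_degree4:
  assumes "\<mu> \<in> monoms_on V" "mdeg \<mu> = 4"
  shows "mon \<mu> \<in> W"
proof -
  obtain a \<mu>1 where 1: "a \<in> V" "\<mu>1 \<in> monoms_on V" "mdeg \<mu>1 = 3" "\<mu> = Poly_Mapping.single a 1 + \<mu>1"
    using monom_SucE[of \<mu> V 3] assms by auto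
  obtain b \<mu>2 where 2: "b \<in> V" "\<mu>2 \<in> monoms_on V" "mdeg \<mu>2 = 2" "\<mu>1 = Poly_Mapping.single b 1 + \<mu>2"
    using monom_SucE[of \<mu>1 V 2] 1 by auto
  obtain c \<mu>3 where 3: "c \<in> V" "\<mu>3 \<in> monoms_on V" "mdeg \<mu>3 = 1" "\<mu>2 = Poly_Mapping.single c 1 + \<mu>3"
    using monom_SucE[of \<mu>2 V 1] 2 by auto
  obtain e \<mu>4 where 4: "e \<in> V" "mdeg \<mu>4 = 0" "\<mu>3 = Poly_Mapping.single e 1 + \<mu>4"
    using monom_SucE[of \<mu>3 V 0] 3 by auto
  have "(mon \<mu> :: (abc_var, 'k) mpoly) = PVar a * PVar b * (PVar c * PVar e)"
    using 1 2 3 4 by (simp add: PVar_def mult_single ac_simps)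
  then show ?thesis using degree4_W 1(1) 2(1) 3(1) 4(1) by simp
qed

lemma mon_degree5:
  assumes "\<mu> \<in> monoms_on V" "mdeg \<mu> = 5"
  shows "mon \<mu> \<in> I2"
proof -
  obtain a \<nu> where 1: "a \<in> V" "\<nu> \<in> monoms_on V" "mdeg \<nu> = 4" "\<mu> = Poly_Mapping.single a 1 + \<nu>"
    using monom_SucE[of \<mu> V 4] assms by auto
  then show ?thesis using mult_W_I2 mon_degree4 unfolding 1(4) mon_add PVar_mon[symmetric] by blast
qed

section \<open>The Hilbert functions\<close>

text \<open>For \<open>y\<close> in \<open>V\<close>, a choice among the quadrics that contract
  \<open>F\<close> to the dual of \<open>y\<close>. The chosen quadrics give a basis in degree 2 and
  define the dual functionals in degree 1.\<close>

definition qsel :: "abc_var \<Rightarrow> abc_var monom" where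
  "qsel y = (SOME q. \<exists>l i. y = X l i \<and> q \<in> qmon l i)"

lemma qsel:
  obtains j where "X l i = X l j" "qsel (X l i) \<in> qmon l j"
proof -
  have "\<exists>p j. X l i = X p j \<and> qsel (X l i) \<in> qmon p j"
    unfolding qsel_def
  proof (rule someI_ex, intro exI conjI)
    show "sx l (i + 1) + sx l (i + 1) \<in> qmon l i" by (simp add: qmon_def)
  qed simp
  then obtain p j where "X l i = X p j" "qsel (X l i) \<in> qmon p j" by blast
  then show ?thesis using that by auto
qed

lemma qsel_X_T: "qsel (X l i) + \<kappa> \<in> T \<longleftrightarrow> \<kappa> = sx l i"
proof -
  obtain j where "X l i = X l j" "qsel (X l i) \<in> qmon l j" by (rule qsel)
  then show ?thesis using qmon_T by metis
qed

lemma qsel_T: "y \<in> V \<Longrightarrow> qsel y + \<kappa> \<in> T \<longleftrightarrow> \<kappa> = Poly_Mapping.single y 1"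
  using qsel_X_T V_cases by metis

lemma qmon_mdeg: "q \<in> qmon l i \<Longrightarrow> mdeg q = 2"
  by (auto simp: qmon_def mdeg_add)

lemma qsel_mdeg: "y \<in> V \<Longrightarrow> mdeg (qsel y) = 2"
  using qsel qmon_mdeg V_cases by metis

lemma qsel_V: "y \<in> V \<Longrightarrow> qsel y \<in> monoms_on V"
  using qsel qmon_V V_cases by metis

lemma quads_qsel: "q \<in> quads l i \<Longrightarrow> q - mon (qsel (X l i)) \<in> I"
  by (auto simp: quads_def qmon_T qsel_X_T qmon_V qsel_V intro!: mon_diff_in_I)

lemma hilbert_0: "quot_hilbert V I 0 1"
proof -
  have "quot_hilbert V I 0 (card {()})"
  \<comment> \<open>The functional is the coefficient of \<open>Dual (delta 0)\<close> in the
    contraction of \<open>F\<close>; any term of \<open>F\<close> could serve.\<close>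
  proof (rule quot_hilbertI[OF Ann_ideal, where v = "\<lambda>_. 1" and \<phi> = "\<lambda>_ \<nu>. of_bool (\<nu> + delta 0 \<in> T)"])
    fix \<mu> assume "\<mu> \<in> monoms_on V" "mdeg \<mu> = 0"
    then show "mon \<mu> \<in> ideal_span V I {()} (\<lambda>_. 1)"
      using ideal_span_generator[OF I_ideal, where X = "{()}" and x = "()" and v = "\<lambda>_. 1"] by simp
  qed (simp_all add: I_weight_sum delta_in_T graded_part_def)
  then show ?thesis by simp
qed

text \<open>Multiplication followed by contraction of \<open>F\<close> pairs degree 1 with degree 2.
  The variables and the quadrics \<open>qsel y\<close> are dual under this pairing, which serves
  \<open>hilbert_2\<close> as well.\<close>

lemma hilbert_1: "quot_hilbert V I 1 (card V)"
proof (rule quot_hilbertI[OF Ann_ideal V_finite, where v = PVar and \<phi> = "\<lambda>y \<nu>. of_bool (\<nu> + qsel y \<in> T)"])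
  fix \<mu> assume "\<mu> \<in> monoms_on V" "mdeg \<mu> = 1"
  then obtain v where "v \<in> V" "\<mu> = Poly_Mapping.single v 1" by (rule mdeg_1E)
  then show "mon \<mu> \<in> ideal_span V I V PVar"
    using ideal_span_generator[OF I_ideal V_finite, of v PVar] by (simp add: PVar_mon)
next
  fix y z assume "y \<in> V" "z \<in> V"
  then show "weight_sum (\<lambda>\<nu>. of_bool (\<nu> + qsel y \<in> T)) (PVar z :: (abc_var, 'k) mpoly) = (if y = z then 1 else 0)"
    by (simp add: PVar_mon add.commute[of _ "qsel y"] qsel_T single_1_eq_iff)
qed (auto simp: I_weight_sum graded_part_def PVar_mon)

lemma hilbert_2: "quot_hilbert V I 2 (card V)"
proof (rule quot_hilbertI[OF Ann_ideal V_finite, where v = "\<lambda>y. mon (qsel y)"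
      and \<phi> = "\<lambda>y \<nu>. of_bool (\<nu> + Poly_Mapping.single y 1 \<in> T)"])
  fix \<mu> assume "\<mu> \<in> monoms_on V" "mdeg \<mu> = 2"
  then obtain y z where yz: "y \<in> V" "z \<in> V" "\<mu> = Poly_Mapping.single y 1 + Poly_Mapping.single z 1"
    by (rule mdeg_2E)
  have \<mu>: "mon \<mu> = (PVar y * PVar z :: (abc_var, 'k) mpoly)"
    unfolding yz(3) by (simp only: mon_add PVar_mon)
  show "mon \<mu> \<in> ideal_span V I V (\<lambda>y. mon (qsel y))"
  proof (cases "nadj y z")
    case True
    then show ?thesis unfolding \<mu> using nadj_I yz ideal_span_ideal[OF Ann_ideal] by blast
  next
    case False
    then obtain l i where "PVar y * PVar z \<in> quads l i" using adj_quads yz by blast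
    then have "PVar y * PVar z - mon (qsel (X l i)) \<in> I" by (rule quads_qsel)
    moreover have "mon (qsel (X l i)) \<in> ideal_span V I V (\<lambda>y. mon (qsel y))"
      by (rule ideal_span_generator[OF Ann_ideal V_finite]) simp
    ultimately show ?thesis unfolding \<mu> by (rule ideal_span_cong[OF Ann_ideal])
  qed
qed (auto simp: I_weight_sum graded_part_def qsel_T qsel_mdeg qsel_V single_1_eq_iff)

lemma T_add: "\<mu> + \<kappa> \<in> T \<Longrightarrow> mdeg \<mu> + mdeg \<kappa> = 3"
  using T_mdeg mdeg_add by metis

text \<open>In degree 3 the only possible cofactor is 1, so all terms of \<open>F\<close> are
  congruent modulo \<open>I\<close> and every other monomial lies in \<open>I\<close>.\<close>

lemma hilbert_3: "quot_hilbert V I 3 1"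
proof -
  have "quot_hilbert V I 3 (card {()})"
  proof (rule quot_hilbertI[OF Ann_ideal, where v = "\<lambda>_. mon (delta 0)" and \<phi> = "\<lambda>_ \<nu>. of_bool (\<nu> + 0 \<in> T)"])
    fix \<mu> assume \<mu>: "\<mu> \<in> monoms_on V" "mdeg \<mu> = 3"
    have T: "\<mu> + \<kappa> \<in> T \<longleftrightarrow> \<kappa> = 0 \<and> \<mu> \<in> T" if "mdeg \<mu> = 3" for \<mu> \<kappa>
      using T_add[of \<mu> \<kappa>] that by auto
    show "mon \<mu> \<in> ideal_span V I {()} (\<lambda>_. mon (delta 0))"
    proof (cases "\<mu> \<in> T")
      case True
      then have "mon \<mu> - mon (delta 0) \<in> I"
        using T[OF \<mu>(2)] T[OF T_mdeg[OF delta_in_T]] T_monoms delta_in_T by (intro mon_diff_in_I) auto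
      then show ?thesis
        by (rule ideal_span_cong[OF Ann_ideal]) (rule ideal_span_generator[OF Ann_ideal], simp_all)
    next
      case False
      then have "mon \<mu> \<in> I" using T[OF \<mu>(2)] \<mu> by (intro mon_in_I) auto
      then show ?thesis by (rule ideal_span_ideal[OF Ann_ideal])
    qed
  qed (auto simp: I_weight_sum[where \<kappa> = 0, simplified] delta_in_T graded_part_def T_mdeg T_monoms)
  then show ?thesis by simp
qed

lemma hilbert_large:
  assumes "i \<ge> 4"
  shows "quot_hilbert V I i 0"
proof (rule quot_hilbert_zeroI[OF Ann_ideal])
  fix \<mu> assume "\<mu> \<in> monoms_on V" "mdeg \<mu> = i"
  then show "mon \<mu> \<in> I" using T_add[of \<mu>] assms by (intro mon_in_I) auto
qed

lemma hilbert_function: "has_hilbert_function V I [1, card V, card V, 1]"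
  unfolding has_hilbert_function_def
proof
  fix i :: nat
  consider "i = 0" | "i = 1" | "i = 2" | "i = 3" | "i \<ge> 4" by linarith
  then show "quot_hilbert V I i (if i < length [1, card V, card V, 1] then [1, card V, card V, 1] ! i else 0)"
    using hilbert_0 hilbert_1 hilbert_2 hilbert_3 hilbert_large[of i] by cases (simp_all add: numeral_2_eq_2 numeral_3_eq_3)
qed

text \<open>The functional \<open>weight_sum (phi y)\<close> sends \<open>s\<close> to the constant term of \<open>(\<partial>s/\<partial>y) \<cdot> F\<close>.\<close>

definition phi :: "abc_var \<Rightarrow> abc_var monom \<Rightarrow> 'k" where
  "phi y \<mu> = of_nat (Poly_Mapping.lookup \<mu> y) * of_bool (\<mu> - Poly_Mapping.single y 1 \<in> T)"

text \<open>Subtraction of exponents is truncated; where \<open>y\<close> does not occur, the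
  meaningless quotient is cancelled by the factor 0.\<close>

lemma phi_Leibniz:
  "phi y (\<mu> + \<nu>) = of_nat (Poly_Mapping.lookup \<mu> y) * of_bool (\<nu> + (\<mu> - Poly_Mapping.single y 1) \<in> T)
     + of_nat (Poly_Mapping.lookup \<nu> y) * of_bool (\<mu> + (\<nu> - Poly_Mapping.single y 1) \<in> T)"
proof -
  let ?y = "Poly_Mapping.single y (1::nat)"
  have 1: "\<mu> + \<nu> - ?y = \<nu> + (\<mu> - ?y)" if "Poly_Mapping.lookup \<mu> y \<noteq> 0" for \<mu> \<nu> :: "abc_var monom"
    using that by (auto intro!: poly_mapping_eqI simp: lookup_add lookup_minus lookup_single when_def)
  have 2: "\<mu> + \<nu> - ?y = \<mu> + (\<nu> - ?y)" if "Poly_Mapping.lookup \<nu> y \<noteq> 0"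
    using 1[OF that, of \<mu>] by (simp add: add.commute)
  show ?thesis
    using 1[of \<mu> \<nu>] 2
    by (cases "Poly_Mapping.lookup \<mu> y = 0"; cases "Poly_Mapping.lookup \<nu> y = 0")
      (simp_all add: phi_def lookup_add algebra_simps)
qed

lemma phi_prod:
  assumes "a \<in> I" "b \<in> I"
  shows "weight_sum (phi y) (a * b) = 0"
proof -
  let ?y = "Poly_Mapping.single y (1::nat)" and ?l = "\<lambda>\<mu>. of_nat (Poly_Mapping.lookup \<mu> y) :: 'k"
  let ?t = "\<lambda>\<mu> \<nu>. of_bool (\<mu> + (\<nu> - ?y) \<in> T) :: 'k"
  \<comment> \<open>The summands with the derivative on \<open>a\<close> vanish: for each
    \<open>\<mu>\<close> they apply to \<open>b\<close> a functional that vanishes on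
    \<open>I\<close>.\<close>
  have "weight_sum (phi y) (a * b) = (\<Sum>\<mu>\<in>Poly_Mapping.keys a. Poly_Mapping.lookup a \<mu> * weight_sum (\<lambda>\<nu>. ?l \<nu> * ?t \<mu> \<nu>) b)"
    using I_weight_sum[OF assms(2)]
    by (simp add: weight_sum_mult phi_Leibniz weight_sum_add_fun weight_sum_scale_fun)
  \<comment> \<open>Exchanging the sums puts \<open>a\<close> innermost, where its membership in
    \<open>I\<close> can be used.\<close>
  also have "\<dots> = (\<Sum>\<nu>\<in>Poly_Mapping.keys b. Poly_Mapping.lookup b \<nu> * ?l \<nu> * weight_sum (\<lambda>\<mu>. ?t \<mu> \<nu>) a)"
    unfolding weight_sum_def sum_distrib_left by (subst sum.swap) (simp only: mult_ac)
  also have "\<dots> = 0"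
    using I_weight_sum[OF assms(1)] by simp
  finally show ?thesis .
qed

lemma phi_I2: "p \<in> I2 \<Longrightarrow> weight_sum (phi y) p = 0"
  by (induction rule: ideal_prod.induct) (simp_all add: phi_prod weight_sum_add)

lemma phi_mu:
  assumes "y \<in> V" "z \<in> V"
  shows "phi y (mu z) = (if y = z then 1 else 0)"
proof -
  obtain l i where z: "z = X l i" using assms V_cases by blast
  let ?p = "other_letter (X l i)"
  have p: "?p \<noteq> l" "l \<noteq> ?p" using other_letter_X[of l i] by metis+
  show ?thesis
  proof (cases "y = z")
    case True
    have "mu z - Poly_Mapping.single z 1 = alpha ?p i" unfolding z mu_X by simp
    moreover have "Poly_Mapping.lookup (mu z) z = 1"
      unfolding z mu_X by (simp add: lookup_add lookup_alpha)
    ultimately show ?thesis using True by (simp add: phi_def alpha_in_T)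
  next
    case False
    show ?thesis
    proof (cases "Poly_Mapping.lookup (mu z) y = 0")
      case True
      then show ?thesis using False by (simp add: phi_def)
    next
      case y: False
      \<comment> \<open>Division by \<open>y\<close> leaves \<open>z\<close>, which differs from
        \<open>y\<close>, and at least one copy of \<open>X ?p (i + 1)\<close>, which has exponent
        2. These two are nonadjacent, so the quotient is no term of \<open>F\<close>.\<close>
      let ?r = "mu z - Poly_Mapping.single y 1"
      have "z \<in> Poly_Mapping.keys ?r"
        using False unfolding z mu_X by (simp add: in_keys_iff lookup_add lookup_minus lookup_single)
      moreover have "X ?p (i + 1) \<in> Poly_Mapping.keys ?r"
        unfolding z mu_X by (simp add: in_keys_iff lookup_add lookup_minus lookup_single lookup_alpha when_def)
      moreover have "nadj z (X ?p (i + 1))"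
        unfolding z using p by (simp add: nadj_iff)
      ultimately have "?r \<notin> T" using T_nadj by blast
      then show ?thesis using False by (simp add: phi_def)
    qed
  qed
qed

lemma hilbert_square_4: "quot_hilbert V I2 4 (card V)"
  by (rule quot_hilbertI[OF I2_ideal V_finite, where v = "\<lambda>y. mon (mu y)" and \<phi> = phi])
    (auto simp: phi_I2 phi_mu graded_part_def mu_deg mu_V mon_degree4)

lemma hilbert_square_5: "quot_hilbert V I2 5 0"
  by (rule quot_hilbert_zeroI[OF I2_ideal]) (rule mon_degree5)

end

theorem proposition3p11:
  fixes m :: nat and F :: "(abc_var, 'k::field) dpoly"
  assumes "m \<ge> 6"
    and "F = dual_element (abc_cubic m)"
  shows "apolar_small_tangent_space (abc_vars m) F"
proof -
  interpret cyclic_cubic m F by unfold_locales (rule assms)+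
  show ?thesis
    unfolding apolar_small_tangent_space_def Let_def
    using F_degree hilbert_function hilbert_square_4 hilbert_square_5 by blast
qed

end
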